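(* Let $z:(0,\infty)\to[0,\infty)$ be nonincreasing, set $c(\phi)=z(\phi)\phi$ for $\phi>0$ and $c(0)=0$, and let $\tau^z(w)=\inf\{F^c[\psi]\mid\psi:\mathbb{R}\to[0,\infty),\ \int_{\mathbb{R}}\psi\,dy=w\}$ for $w\geq0$. Denoting by $(\tau^z)'$ the right derivative, we have $$(\tau^z)'(0)=\lim_{\phi\searrow0}z(\phi)\qquad\text{and}\qquad\lim_{w\to\infty}(\tau^z)'(w)=\lim_{\phi\to\infty}z(\phi)$$ (as values in $[0,\infty]$).
   Context: For $c:[0,\infty)\to[0,\infty)$ and $\psi:\mathbb{R}\to\mathbb{R}$ (with locally integrable weak derivative; otherwise the energy is $+\infty$), $F^c[\psi]=\int_{\mathbb{R}}\frac12|\psi'(y)|^2+c(|\psi(y)|)\,dy$.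
   Formalization: The second limit is stated under the added assumption that τ^z is finite on [0,∞); for e.g. z(φ)=φ^{-3} one has τ^z=∞ on (0,∞), so its right derivative at w>0 is undefined. Finiteness at one w>0 implies finiteness everywhere, so only such cases are excluded. *)

theory Defs
  imports "HOL-Analysis.Analysis"
begin

definition test_fun :: "(real \<Rightarrow> real) \<Rightarrow> bool" where
  "test_fun \<phi> \<longleftrightarrow>
     (\<forall>n x. ((deriv ^^ n) \<phi>) differentiable (at x)) \<and> bounded {x. \<phi> x \<noteq> 0}"

definition loc_integrable :: "(real \<Rightarrow> real) \<Rightarrow> bool" where
  "loc_integrable f \<longleftrightarrow> (\<forall>a b. set_integrable lborel {a..b} f)"

definition weak_deriv :: "(real \<Rightarrow> real) \<Rightarrow> (real \<Rightarrow> real) \<Rightarrow> bool" where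
  "weak_deriv \<psi> g \<longleftrightarrow> loc_integrable \<psi> \<and> loc_integrable g \<and>
     (\<forall>\<phi>. test_fun \<phi> \<longrightarrow>
        (\<integral>y. \<psi> y * deriv \<phi> y \<partial>lborel) = - (\<integral>y. g y * \<phi> y \<partial>lborel))"

text \<open>The energy F^c[psi]; it is +infinity if psi has no locally integrable weak
  derivative (infimum over the empty set). All weak derivatives agree a.e., so the
  infimum over them is just the value for any one of them.\<close>
definition energy :: "(real \<Rightarrow> real) \<Rightarrow> (real \<Rightarrow> real) \<Rightarrow> ennreal" where
  "energy c \<psi> = (INF g\<in>{g. weak_deriv \<psi> g}.
      \<integral>\<^sup>+ y. ennreal ((\<bar>g y\<bar>)\<^sup>2 / 2 + c \<bar>\<psi> y\<bar>) \<partial>lborel)"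

definition c_of :: "(real \<Rightarrow> real) \<Rightarrow> real \<Rightarrow> real" where
  "c_of z \<phi> = (if \<phi> > 0 then z \<phi> * \<phi> else 0)"

definition tau :: "(real \<Rightarrow> real) \<Rightarrow> real \<Rightarrow> ereal" where
  "tau z w = enn2ereal (INF \<psi>\<in>{\<psi>. (\<forall>y. \<psi> y \<ge> 0) \<and>
        (\<integral>\<^sup>+ y. ennreal (\<psi> y) \<partial>lborel) = ennreal w}. energy (c_of z) \<psi>)"

end

theory Submission
  imports Defs
begin

text \<open>By the du Bois-Reymond lemma every profile of finite energy has a continuous representative that
is the integral of its weak derivative, so profiles can be cut and glued.

Let \<open>\<psi>\<close> be a nearly optimal profile of mass \<open>w\<close> with maximum \<open>m\<close>. Inserting a plateau at the maximum
adds mass \<open>h\<close> at cost \<open>z m * h\<close>. To remove mass \<open>h\<close>, view \<open>\<psi>\<close> as a function \<open>p\<close> of the mass to its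
left, with \<open>p 0 = p w = 0\<close> and \<open>p \<ge> 0\<close>: by the intermediate value theorem \<open>p s = p (s + h)\<close> for some
\<open>s\<close>, and the piece between these points, which can be cut out, has energy at least \<open>z m * h\<close>. So
\<open>z m\<close> is (up to an arbitrarily small error) a supergradient of \<open>tau z\<close> at \<open>w\<close>; hence \<open>tau z\<close> is
concave where it is finite, and its slopes are at least \<open>inf z\<close>. Scaling a profile up to height \<open>M\<close>
and inserting long plateaus gives \<open>tau z w \<le> C + z M * w\<close>, which yields the limit at infinity.

At zero, wide flat profiles give \<open>tau z h \<le> sup z * h\<close>. Conversely, a profile of mass \<open>h\<close> and energy
at most \<open>K * h\<close> satisfies \<open>\<psi>^3 \<le> 16 * K * h^2\<close>, so it only sees the values of \<open>z\<close> near zero.\<close>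

section \<open>Absolutely continuous functions on the line\<close>

text \<open>Local absolute continuity, stated by gauge integrals over compact intervals so that
  gluing becomes additivity of the integral. Local Lebesgue integrability is included because a weak
  derivative must have it.\<close>

definition ac_with :: "(real \<Rightarrow> real) \<Rightarrow> (real \<Rightarrow> real) \<Rightarrow> bool" where
  "ac_with \<psi> g \<longleftrightarrow> loc_integrable g \<and>
     (\<forall>x y. x \<le> y \<longrightarrow> (g has_integral (\<psi> y - \<psi> x)) {x..y})"

lemma loc_integrableD: "loc_integrable f \<Longrightarrow> set_integrable lborel {a..b} f"
  by (simp add: loc_integrable_def)

lemma loc_integrable_measurable:
  assumes "loc_integrable f" shows "f \<in> borel_measurable borel"
proof (rule borel_measurable_LIMSEQ_real)
  show "(\<lambda>n. indicator {- real n..real n} x * f x) \<longlonglongrightarrow> f x" for x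
  proof (rule tendsto_eventually)
    obtain N where N: "\<bar>x\<bar> \<le> real N" using real_arch_simple by blast
    show "\<forall>\<^sub>F n in sequentially. indicator {- real n..real n} x * f x = f x"
      using eventually_ge_at_top[of N] by eventually_elim (use N in \<open>auto simp: indicator_def\<close>)
  qed
  show "(\<lambda>x. indicator {- real n..real n} x * f x) \<in> borel_measurable borel" for n
    using loc_integrableD[OF assms, of "- real n" "real n"]
    by (auto simp: set_integrable_def dest: borel_measurable_integrable)
qed

lemma loc_integrable_integral_eq:
  "loc_integrable f \<Longrightarrow> (LINT x:{a..b}|lborel. f x) = integral {a..b} f"
  by (rule set_borel_integral_eq_integral(2)) (rule loc_integrableD)

lemma loc_integrable_integrable_on:
  "loc_integrable f \<Longrightarrow> f integrable_on {a..b}"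
  by (rule set_borel_integral_eq_integral(1)) (rule loc_integrableD)

lemma loc_integrable_continuous:
  assumes "continuous_on UNIV f" shows "loc_integrable f"
  unfolding loc_integrable_def set_integrable_def
  by (metis assms borel_integrable_compact compact_Icc continuous_on_subset subset_UNIV)

lemma loc_integrable_diff:
  "loc_integrable f \<Longrightarrow> loc_integrable g \<Longrightarrow> loc_integrable (\<lambda>x. f x - g x)"
  unfolding loc_integrable_def by (auto intro: set_integral_diff)

lemma loc_integrable_mult_left:
  "loc_integrable f \<Longrightarrow> loc_integrable (\<lambda>x. c * f x)"
  unfolding loc_integrable_def by auto

lemma loc_integrable_shift:
  assumes "loc_integrable f" shows "loc_integrable (\<lambda>x. f (x + d))"
  unfolding loc_integrable_def set_integrable_def
proof (intro allI)
  fix a b :: real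
  have "integrable lborel (\<lambda>x. indicator {a + d..b + d} x *\<^sub>R f x)"
    using loc_integrableD[OF assms] by (simp add: set_integrable_def)
  from lborel_integrable_real_affine[OF this, of 1 d]
  show "integrable lborel (\<lambda>x. indicat_real {a..b} x *\<^sub>R f (x + d))"
    by (simp add: indicator_def add.commute)
qed

lemma loc_integrable_join:
  assumes "loc_integrable f" "loc_integrable g"
  shows "loc_integrable (\<lambda>x. if x \<le> a then f x else g x)"
  unfolding loc_integrable_def set_integrable_def
proof (intro allI)
  fix b c :: real
  have [measurable]: "f \<in> borel_measurable borel" "g \<in> borel_measurable borel"
    using assms by (auto intro: loc_integrable_measurable)
  have "integrable lborel (\<lambda>x. norm (indicator {b..c} x *\<^sub>R f x) + norm (indicator {b..c} x *\<^sub>R g x))"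
    using assms by (intro Bochner_Integration.integrable_add integrable_norm)
      (auto simp: loc_integrable_def set_integrable_def)
  then show "integrable lborel (\<lambda>x. indicat_real {b..c} x *\<^sub>R (if x \<le> a then f x else g x))"
    by (rule Bochner_Integration.integrable_bound) (auto simp: indicator_def)
qed

lemma ac_withD:
  "ac_with \<psi> g \<Longrightarrow> x \<le> y \<Longrightarrow> (g has_integral (\<psi> y - \<psi> x)) {x..y}"
  by (simp add: ac_with_def)

lemma ac_with_loc: "ac_with \<psi> g \<Longrightarrow> loc_integrable g"
  by (simp add: ac_with_def)

text \<open>The primitive is the signed integral from 0, split into cases because the integral over
  an interval with reversed endpoints is 0.\<close>

lemma ac_with_indefinite_integral:
  assumes "loc_integrable g"
  shows "ac_with (\<lambda>y. if 0 \<le> y then integral {0..y} g else - integral {y..0} g) g"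
proof -
  have i: "g integrable_on {a..b}" for a b by (rule loc_integrable_integrable_on[OF assms])
  have c: "integral {a..b} g + integral {b..c} g = integral {a..c} g" if "a \<le> b" "b \<le> c" for a b c
    by (rule Henstock_Kurzweil_Integration.integral_combine[OF that i])
  show ?thesis unfolding ac_with_def
  proof (intro conjI allI impI assms)
    fix x y :: real assume xy: "x \<le> y"
    have "integral {x..y} g = (if 0 \<le> y then integral {0..y} g else - integral {y..0} g) -
       (if 0 \<le> x then integral {0..x} g else - integral {x..0} g)"
      using c[of 0 x y] c[of x 0 y] c[of x y 0] xy by auto
    then show "(g has_integral (if 0 \<le> y then integral {0..y} g else - integral {y..0} g) -
       (if 0 \<le> x then integral {0..x} g else - integral {x..0} g)) {x..y}"
      using integrable_integral[OF i] by metis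
  qed
qed

lemma ac_with_continuous:
  assumes "ac_with \<psi> g" shows "continuous_on UNIV \<psi>"
proof -
  have "continuous_on {-R<..<R} \<psi>" if "R > 0" for R
  proof -
    have "continuous_on {-R..R} (\<lambda>y. integral {-R..y} g)"
      by (rule indefinite_integral_continuous_1)
        (rule loc_integrable_integrable_on[OF ac_with_loc[OF assms]])
    then have "continuous_on {-R..R} (\<lambda>y. \<psi> (-R) + integral {-R..y} g)"
      by (intro continuous_intros)
    moreover have "\<psi> (-R) + integral {-R..y} g = \<psi> y" if "y \<in> {-R..R}" for y
      using integral_unique[OF ac_withD[OF assms, of "-R" y]] that by simp
    ultimately have "continuous_on {-R..R} \<psi>" by (rule continuous_on_eq)
    then show ?thesis by (rule continuous_on_subset) auto
  qed
  then have "continuous_on (\<Union>R\<in>{0<..}. {-R<..<R}) \<psi>"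
    by (intro continuous_on_open_UN) auto
  moreover have "(\<Union>R\<in>{0<..}. {-R<..<R}) = (UNIV :: real set)"
  proof (intro set_eqI iffI UN_I UNIV_I)
    show "\<bar>x\<bar> + 1 \<in> {0<..}" "x \<in> {- (\<bar>x\<bar> + 1)<..<\<bar>x\<bar> + 1}" for x :: real
      by auto
  qed
  ultimately show ?thesis by simp
qed

lemma ac_with_const: "ac_with (\<lambda>_. c) (\<lambda>_. 0)"
  by (simp add: ac_with_def loc_integrable_continuous)

lemma ac_with_scale: "ac_with \<psi> g \<Longrightarrow> ac_with (\<lambda>y. c * \<psi> y) (\<lambda>y. c * g y)"
  unfolding ac_with_def
  by (auto intro: loc_integrable_mult_left simp flip: right_diff_distrib intro!: has_integral_mult_right)

lemma ac_with_shift: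
  assumes "ac_with \<psi> g" shows "ac_with (\<lambda>y. \<psi> (y + d)) (\<lambda>y. g (y + d))"
  unfolding ac_with_def
proof (intro conjI allI impI)
  show "loc_integrable (\<lambda>y. g (y + d))" by (rule loc_integrable_shift[OF ac_with_loc[OF assms]])
  fix x y :: real assume "x \<le> y"
  then have "(g has_integral (\<psi> (y + d) - \<psi> (x + d))) {x + d..y + d}"
    by (intro ac_withD[OF assms]) simp
  from has_integral_affinity[of g _ "x + d" "y + d" 1 d, simplified, OF this]
  show "((\<lambda>y. g (y + d)) has_integral \<psi> (y + d) - \<psi> (x + d)) {x..y}"
    by simp
qed

lemma ac_with_join:
  assumes 1: "ac_with \<psi>1 g1" and 2: "ac_with \<psi>2 g2" and eq: "\<psi>1 a = \<psi>2 a"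
  shows "ac_with (\<lambda>y. if y \<le> a then \<psi>1 y else \<psi>2 y) (\<lambda>y. if y \<le> a then g1 y else g2 y)"
    (is "ac_with ?\<psi> ?g")
  unfolding ac_with_def
proof (intro conjI allI impI)
  show "loc_integrable ?g"
    by (intro loc_integrable_join ac_with_loc[OF 1] ac_with_loc[OF 2])
  have left: "(?g has_integral (\<psi>1 y - \<psi>1 x)) {x..y}" if "x \<le> y" "y \<le> a" for x y
    by (rule has_integral_eq[OF _ ac_withD[OF 1]]) (use that in auto)
  \<comment> \<open>At \<open>a\<close> the glued derivative takes the value of \<open>g1\<close>,
    so it agrees with \<open>g2\<close> only off a single point.\<close>
  have right: "(?g has_integral (\<psi>2 y - \<psi>2 x)) {x..y}" if "x \<le> y" "a \<le> x" for x y
    by (rule has_integral_spike_finite[OF _ _ ac_withD[OF 2], of "{a}"]) (use that in auto)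
  fix x y :: real assume "x \<le> y"
  then consider "y \<le> a" | "x \<le> a" "a < y" | "a < x" by linarith
  then show "(?g has_integral (?\<psi> y - ?\<psi> x)) {x..y}"
  proof cases
    case 1 then show ?thesis using left[OF \<open>x \<le> y\<close>] \<open>x \<le> y\<close> by simp
  next
    case 2
    from has_integral_combine[OF _ _ left right, of x a y] 2 eq show ?thesis
      by (simp add: algebra_simps)
  next
    case 3 then show ?thesis using right[OF \<open>x \<le> y\<close>] \<open>x \<le> y\<close> by simp
  qed
qed

lemma ac_with_of_has_deriv:
  assumes "\<And>x. (f has_real_derivative f' x) (at x)" "continuous_on UNIV f'"
  shows "ac_with f f'"
  unfolding ac_with_def
proof (intro conjI allI impI)
  show "loc_integrable f'" by (rule loc_integrable_continuous[OF assms(2)])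
  fix x y :: real assume "x \<le> y"
  then show "(f' has_integral f y - f x) {x..y}"
    by (rule fundamental_theorem_of_calculus)
      (use assms(1) in \<open>auto simp flip: has_real_derivative_iff_has_vector_derivative intro: DERIV_subset\<close>)
qed

section \<open>Weak derivatives\<close>

lemma test_fun_has_deriv:
  "test_fun \<phi> \<Longrightarrow> (\<phi> has_real_derivative deriv \<phi> x) (at x)"
  unfolding test_fun_def by (metis DERIV_deriv_iff_real_differentiable funpow_0)

lemma test_fun_deriv_continuous:
  assumes "test_fun \<phi>" shows "continuous_on UNIV (deriv \<phi>)"
proof (rule differentiable_imp_continuous_on)
  have "((deriv ^^ 1) \<phi>) differentiable (at x)" for x
    using assms unfolding test_fun_def by blast
  then show "deriv \<phi> differentiable_on UNIV" by (simp add: differentiable_on_def)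
qed

lemma test_fun_support:
  assumes "test_fun \<phi>" obtains R where "R > 0" "\<And>x. R \<le> \<bar>x\<bar> \<Longrightarrow> \<phi> x = 0" "\<And>x. R \<le> \<bar>x\<bar> \<Longrightarrow> deriv \<phi> x = 0"
proof -
  obtain B where B: "B > 0" "\<And>x. \<phi> x \<noteq> 0 \<Longrightarrow> \<bar>x\<bar> \<le> B"
    using assms unfolding test_fun_def bounded_pos by auto
  have 0: "\<phi> x = 0" if "x \<in> - {-B..B}" for x
    using B(2)[of x] that by (cases "\<phi> x = 0") (auto simp: abs_le_iff)
  have "deriv \<phi> x = 0" if "B + 1 \<le> \<bar>x\<bar>" for x
  proof (rule DERIV_imp_deriv)
    have op: "open (- {-B..B})" by (intro open_Compl closed_real_atLeastAtMost)
    show "(\<phi> has_real_derivative 0) (at x)"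
      by (rule has_field_derivative_transform_within_open[OF DERIV_const[of 0] op])
        (use 0 that in auto)
  qed
  moreover have "\<phi> x = 0" if "B + 1 \<le> \<bar>x\<bar>" for x
    by (rule 0) (use that in auto)
  ultimately show ?thesis using B(1) by (intro that[of "B + 1"]) auto
qed

text \<open>Integration by parts by Fubini: integrate \<open>g s * deriv \<phi> y\<close> over the
  triangle -R \<le> s \<le> y \<le> R. Its sections give \<open>\<psi> y - \<psi> (-R)\<close> for
  fixed \<open>y\<close> and \<open>- \<phi> s\<close> for fixed \<open>s\<close>.\<close>

lemma ac_with_imp_weak_deriv:
  assumes ac: "ac_with \<psi> g" shows "weak_deriv \<psi> g"
  unfolding weak_deriv_def
proof (intro conjI allI impI)
  show "loc_integrable \<psi>" by (rule loc_integrable_continuous[OF ac_with_continuous[OF ac]])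
  show g: "loc_integrable g" by (rule ac_with_loc[OF ac])
  fix \<phi> assume t: "test_fun \<phi>"
  obtain R where R: "R > 0" "\<And>x. R \<le> \<bar>x\<bar> \<Longrightarrow> \<phi> x = 0" "\<And>x. R \<le> \<bar>x\<bar> \<Longrightarrow> deriv \<phi> x = 0"
    using test_fun_support[OF t] by blast
  define f where "f = deriv \<phi>"
  have fl: "loc_integrable f" unfolding f_def
    by (rule loc_integrable_continuous[OF test_fun_deriv_continuous[OF t]])
  have gm [measurable]: "g \<in> borel_measurable borel" and fm [measurable]: "f \<in> borel_measurable borel"
    using g fl by (auto intro: loc_integrable_measurable)
  have intf: "(LINT y:{a..b}|lborel. f y) = \<phi> b - \<phi> a" if "a \<le> b" for a b
  proof -
    have "(f has_integral \<phi> b - \<phi> a) {a..b}"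
      by (rule fundamental_theorem_of_calculus[OF that])
        (use test_fun_has_deriv[OF t] in \<open>auto simp: f_def
          simp flip: has_real_derivative_iff_has_vector_derivative intro: DERIV_subset\<close>)
    then show ?thesis using loc_integrable_integral_eq[OF fl] integral_unique by metis
  qed
  have intg: "(LINT y:{a..b}|lborel. g y) = \<psi> b - \<psi> a" if "a \<le> b" for a b
    using loc_integrable_integral_eq[OF g] integral_unique[OF ac_withD[OF ac that]] by metis
  let ?I = "indicat_real {-R..R}"
  define k where "k = (\<lambda>s y. of_bool (s \<le> y) * ((?I s * g s) * (?I y * f y)))"
  have ig: "integrable lborel (\<lambda>s. ?I s * g s)" and if': "integrable lborel (\<lambda>s. ?I s * f s)"
    using loc_integrableD[OF g, of "-R" R] loc_integrableD[OF fl, of "-R" R] by (auto simp: set_integrable_def)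
  have "integrable (lborel \<Otimes>\<^sub>M lborel) (\<lambda>(s, y). (?I s * g s) * (?I y * f y))"
  proof (rule lborel_pair.Fubini_integrable)
    show "integrable lborel (\<lambda>x. LINT y|lborel. norm (case (x, y) of (s, y) \<Rightarrow> (?I s * g s) * (?I y * f y)))"
      using integrable_norm[OF ig] by (simp add: abs_mult)
  qed (use if' in auto)
  then have ik: "integrable (lborel \<Otimes>\<^sub>M lborel) (\<lambda>(s, y). k s y)"
    by (rule Bochner_Integration.integrable_bound) (auto simp: k_def split_beta)
  have k1: "(LINT y|lborel. k s y) = - (g s * \<phi> s)" for s
  proof (cases "s \<in> {-R..R}")
    case True
    have "(LINT y|lborel. k s y) = (LINT y|lborel. g s * (indicator {s..R} y * f y))"
      by (rule Bochner_Integration.integral_cong) (use True in \<open>auto simp: k_def indicator_def\<close>)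
    also have "\<dots> = g s * (LINT y:{s..R}|lborel. f y)"
      by (simp add: set_lebesgue_integral_def)
    finally show ?thesis using True R intf[of s R] by simp
  next
    case False
    then have "\<phi> s = 0" "?I s = 0" using R(2)[of s] by auto
    then show ?thesis by (simp add: k_def)
  qed
  have k2: "(LINT s|lborel. k s y) = ?I y * f y * (\<psi> y - \<psi> (-R))" for y
  proof (cases "y \<in> {-R..R}")
    case True
    have "(LINT s|lborel. k s y) = (LINT s|lborel. f y * (indicator {-R..y} s * g s))"
      by (rule Bochner_Integration.integral_cong) (use True in \<open>auto simp: k_def indicator_def\<close>)
    also have "\<dots> = f y * (LINT s:{-R..y}|lborel. g s)"
      by (simp add: set_lebesgue_integral_def)
    finally show ?thesis using True intg[of "-R" y] by simp
  next
    case False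
    then show ?thesis by (simp add: k_def)
  qed
  have "- (LINT s|lborel. g s * \<phi> s) = (LINT s|lborel. (LINT y|lborel. k s y))"
    by (simp add: k1)
  also have "\<dots> = (LINT y|lborel. (LINT s|lborel. k s y))"
    by (rule lborel_pair.Fubini_integral[OF ik, symmetric])
  also have "\<dots> = (LINT y|lborel. ?I y * f y * \<psi> y - \<psi> (-R) * (?I y * f y))"
    by (simp add: k2 algebra_simps)
  also have "\<dots> = (LINT y|lborel. ?I y * f y * \<psi> y) - (LINT y|lborel. \<psi> (-R) * (?I y * f y))"
  proof (rule Bochner_Integration.integral_diff)
    have "loc_integrable (\<lambda>y. f y * \<psi> y)"
      by (intro loc_integrable_continuous continuous_on_mult ac_with_continuous[OF ac])
         (simp add: f_def test_fun_deriv_continuous[OF t])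
    from loc_integrableD[OF this, of "-R" R]
    show "integrable lborel (\<lambda>y. ?I y * f y * \<psi> y)" by (simp add: set_integrable_def mult.assoc)
  qed (use if' in simp)
  \<comment> \<open>The constant \<open>\<psi> (-R)\<close> drops out because \<open>\<phi>\<close>
    vanishes at both ends.\<close>
  also have "(LINT y|lborel. \<psi> (-R) * (?I y * f y)) = 0"
    using intf[of "-R" R] R by (simp add: set_lebesgue_integral_def)
  also have "(LINT y|lborel. ?I y * f y * \<psi> y) = (LINT y|lborel. \<psi> y * deriv \<phi> y)"
  proof (rule Bochner_Integration.integral_cong)
    show "?I y * f y * \<psi> y = \<psi> y * deriv \<phi> y" for y
      using R(3)[of y] by (cases "\<bar>y\<bar> \<le> R") (auto simp: f_def indicator_def)
  qed simp
  finally show "(LINT y|lborel. \<psi> y * deriv \<phi> y) = - (LINT y|lborel. g y * \<phi> y)" by simp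
qed

section \<open>Smooth bumps with compact support\<close>

definition flat_exp :: "real \<Rightarrow> nat \<Rightarrow> real \<Rightarrow> real" where
  "flat_exp a i x = (if x > 0 then inverse x ^ i * exp (- (a * inverse x)) else 0)"

lemma flat_exp_tendsto_0:
  assumes "a > 0" shows "(flat_exp a i \<longlongrightarrow> 0) (at 0)"
proof -
  have "((\<lambda>t. (1 / a ^ i) * ((a * t) ^ i / exp (a * t))) \<longlongrightarrow> (1 / a ^ i) * 0) at_top"
    by (intro tendsto_intros filterlim_compose[OF tendsto_power_div_exp_0]
        filterlim_tendsto_pos_mult_at_top[OF tendsto_const assms filterlim_ident])
  then have "((\<lambda>t. t ^ i * exp (- (a * t))) \<longlongrightarrow> 0) at_top"
    using assms by (simp add: power_mult_distrib exp_minus field_simps)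
  then have "((\<lambda>x. inverse x ^ i * exp (- (a * inverse x))) \<longlongrightarrow> 0) (at_right 0)"
    by (rule filterlim_compose[OF _ filterlim_inverse_at_top_right])
  then have "(flat_exp a i \<longlongrightarrow> 0) (at_right 0)"
    by (rule Lim_transform_eventually)
      (auto simp: eventually_at_filter flat_exp_def)
  moreover have "(flat_exp a i \<longlongrightarrow> 0) (at_left 0)"
    by (rule Lim_transform_eventually[OF tendsto_const])
      (auto simp: eventually_at_filter flat_exp_def)
  ultimately show ?thesis by (simp add: filterlim_at_split)
qed

text \<open>Differentiation only raises the exponent of \<open>inverse x\<close>, so the derivative
  is a combination of functions of the same family. At 0 the difference quotient is the next
  function of the family, which tends to 0 because the exponential beats every power.\<close>

lemma flat_exp_has_deriv:
  assumes "a > 0"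
  shows "(flat_exp a i has_real_derivative
     (- real i * flat_exp a (Suc i) x + a * flat_exp a (Suc (Suc i)) x)) (at x)"
proof -
  consider "x > 0" | "x < 0" | "x = 0" by linarith
  then show ?thesis
  proof cases
    case 1
    have "((\<lambda>x. inverse x ^ i * exp (- (a * inverse x))) has_real_derivative
       (- real i * flat_exp a (Suc i) x + a * flat_exp a (Suc (Suc i)) x)) (at x)"
    proof -
      have d: "(inverse has_real_derivative - (inverse x ^ 2)) (at x)"
        using DERIV_inverse[of x] 1 by (simp add: power2_eq_square power_Suc)
      have e: "((\<lambda>x. exp (- (a * inverse x))) has_real_derivative
          exp (- (a * inverse x)) * - (a * - (inverse x ^ 2))) (at x)"
        by (intro DERIV_fun_exp DERIV_minus DERIV_cmult d)
      have p: "((\<lambda>x. inverse x ^ i) has_real_derivative - (real i * inverse x ^ Suc i)) (at x)"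
        using DERIV_power[OF d, of i] by (cases i) (simp_all add: power2_eq_square mult_ac)
      show ?thesis using DERIV_mult[OF p e] 1
        by (simp add: flat_exp_def power2_eq_square mult_ac)
    qed
    then show ?thesis
      by (rule has_field_derivative_transform_within_open[of _ _ _ "{0<..}"])
        (use 1 in \<open>auto simp: flat_exp_def\<close>)
  next
    case 2
    show ?thesis
      by (rule has_field_derivative_transform_within_open[of "\<lambda>_. 0" _ _ "{..<0}"])
        (use 2 in \<open>auto simp: flat_exp_def\<close>)
  next
    case 3
    have "((\<lambda>h. (flat_exp a i (0 + h) - flat_exp a i 0) / h) \<longlongrightarrow> 0) (at 0)"
      using flat_exp_tendsto_0[OF assms, of "Suc i"]
      by (rule Lim_transform_eventually)
        (auto simp: eventually_at_filter flat_exp_def divide_inverse)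
    then show ?thesis using 3 by (simp add: DERIV_def flat_exp_def)
  qed
qed

text \<open>Smoothness comes from membership in a class closed under differentiation, which avoids
  any formula for the n-th derivative.\<close>

lemma has_deriv_closed_imp_iterated_differentiable:
  assumes "\<And>f. f \<in> S \<Longrightarrow> \<exists>f'\<in>S. \<forall>x. (f has_real_derivative f' x) (at x)" and "f \<in> S"
  shows "((deriv ^^ n) f) differentiable (at x)"
proof -
  have "(deriv ^^ n) f \<in> S"
  proof (induction n)
    case (Suc n)
    then obtain f' where "f' \<in> S" "\<forall>x. ((deriv ^^ n) f has_real_derivative f' x) (at x)"
      using assms(1) by blast
    moreover then have "deriv ((deriv ^^ n) f) = f'" by (auto intro: DERIV_imp_deriv)
    ultimately show ?case by simp
  qed (use assms(2) in simp)
  then show ?thesis using assms(1) real_differentiable_def by blast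
qed

text \<open>The linear span of products of a rising and a falling flat exponential. Rate
  \<open>a\<close> and width \<open>l\<close> are fixed, while \<open>p\<close> varies so that all
  translates of one bump lie in the same class.\<close>

inductive_set bumps :: "real \<Rightarrow> real \<Rightarrow> (real \<Rightarrow> real) set" for a l where
  base: "(\<lambda>x. flat_exp a i (x - p) * flat_exp a j (p + l - x)) \<in> bumps a l"
| add: "f \<in> bumps a l \<Longrightarrow> g \<in> bumps a l \<Longrightarrow> (\<lambda>x. f x + g x) \<in> bumps a l"
| scale: "f \<in> bumps a l \<Longrightarrow> (\<lambda>x. c * f x) \<in> bumps a l"

lemma bumps_has_deriv:
  assumes "a > 0" "f \<in> bumps a l"
  shows "\<exists>f'\<in>bumps a l. \<forall>x. (f has_real_derivative f' x) (at x)"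
  using assms(2)
proof induction
  case (base i p j)
  let ?b = "\<lambda>i j x. flat_exp a i (x - p) * flat_exp a j (p + l - x)"
  let ?f' = "\<lambda>x. ((- real i) * ?b (Suc i) j x + a * ?b (Suc (Suc i)) j x) +
     (real j * ?b i (Suc j) x + (- a) * ?b i (Suc (Suc j)) x)"
  have mem: "?f' \<in> bumps a l" by (intro bumps.intros)
  have "(?b i j has_real_derivative ?f' x) (at x)" for x
  proof -
    have 1: "((\<lambda>x. flat_exp a i (x - p)) has_real_derivative
       (- real i * flat_exp a (Suc i) (x - p) + a * flat_exp a (Suc (Suc i)) (x - p)) * (1 - 0)) (at x)"
      by (rule DERIV_chain2[OF flat_exp_has_deriv[OF assms(1)]]) (intro derivative_intros)
    have 2: "((\<lambda>x. flat_exp a j (p + l - x)) has_real_derivative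
       (- real j * flat_exp a (Suc j) (p + l - x) + a * flat_exp a (Suc (Suc j)) (p + l - x)) * (0 - 1)) (at x)"
      by (rule DERIV_chain2[OF flat_exp_has_deriv[OF assms(1)]]) (intro derivative_intros)
    show ?thesis using DERIV_mult[OF 1 2] by (simp add: algebra_simps)
  qed
  then have all: "\<forall>x. (?b i j has_real_derivative ?f' x) (at x)" by (rule allI)
  show ?case by (rule bexI[where x = ?f'], rule all, rule mem)
next
  case (add f g)
  then obtain f' g' where "f' \<in> bumps a l" "g' \<in> bumps a l"
    "\<forall>x. (f has_real_derivative f' x) (at x)" "\<forall>x. (g has_real_derivative g' x) (at x)" by blast
  then show ?case by (intro bexI[of _ "\<lambda>x. f' x + g' x"]) (auto intro: DERIV_add bumps.add)
next
  case (scale f c)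
  then obtain f' where "f' \<in> bumps a l" "\<forall>x. (f has_real_derivative f' x) (at x)" by blast
  then show ?case by (intro bexI[of _ "\<lambda>x. c * f' x"]) (auto intro: DERIV_cmult bumps.scale)
qed

lemma ac_with_has_deriv:
  assumes ac: "ac_with \<psi> g" and cont: "continuous_on UNIV g"
  shows "(\<psi> has_real_derivative g x) (at x)"
proof -
  have "((\<lambda>y. integral {x-1..y} g) has_real_derivative g x) (at x within {x-1..x+1})"
    by (rule integral_has_real_derivative) (auto intro: continuous_on_subset[OF cont])
  moreover have "at x within {x-1..x+1} = at x"
    by (rule at_within_interior) (simp add: interior_atLeastAtMost_real)
  ultimately have "((\<lambda>y. \<psi> (x-1) + integral {x-1..y} g) has_real_derivative 0 + g x) (at x)"
    by (intro DERIV_add DERIV_const) simp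
  then have "((\<lambda>y. \<psi> (x-1) + integral {x-1..y} g) has_real_derivative g x) (at x)" by simp
  then show ?thesis
  proof (rule has_field_derivative_transform_within_open[of _ _ _ "{x-1<..<x+1}"])
    show "\<psi> (x-1) + integral {x-1..y} g = \<psi> y" if "y \<in> {x-1<..<x+1}" for y
      using integral_unique[OF ac_withD[OF ac, of "x-1" y]] that by simp
  qed auto
qed

lemma ac_with_eq_of_zero:
  assumes "ac_with \<psi> g" "x \<le> y" "\<And>t. t \<in> {x..y} \<Longrightarrow> g t = 0" shows "\<psi> x = \<psi> y"
  using has_integral_unique[OF ac_withD[OF assms(1,2)] has_integral_is_0[OF assms(3)]] by simp

text \<open>The difference of two translates of a bump has integral zero, so its primitive has
  compact support.\<close>

lemma test_fun_bump_difference: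
  assumes "\<epsilon> > 0" "l > 0"
  defines "\<eta> \<equiv> \<lambda>x. flat_exp \<epsilon> 0 x * flat_exp \<epsilon> 0 (l - x)"
  obtains \<phi> where "test_fun \<phi>" "deriv \<phi> = (\<lambda>x. \<eta> (x - a) - \<eta> (x - b))"
proof -
  have mem: "(\<lambda>x. \<eta> (x - p)) \<in> bumps \<epsilon> l" for p
    using bumps.base[of \<epsilon> 0 p 0 l] by (simp add: \<eta>_def algebra_simps)
  have cont: "continuous_on UNIV (\<lambda>x. \<eta> (x - p))" for p
    using bumps_has_deriv[OF assms(1) mem[of p]] DERIV_isCont continuous_at_imp_continuous_on by blast
  define G where "G = (\<lambda>y. if 0 \<le> y then integral {0..y} \<eta> else - integral {y..0} \<eta>)"
  have c0: "continuous_on UNIV \<eta>" using cont[of 0] by simp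
  have ac: "ac_with G \<eta>" unfolding G_def
    by (intro ac_with_indefinite_integral loc_integrable_continuous c0)
  have z: "\<eta> t = 0" if "t \<le> 0 \<or> l \<le> t" for t using that by (auto simp: \<eta>_def flat_exp_def)
  define \<phi> where "\<phi> = (\<lambda>x. G (x - a) - G (x - b))"
  have dG: "((\<lambda>x. G (x - p)) has_real_derivative \<eta> (x - p)) (at x)" for p x
  proof -
    have "((\<lambda>x. x - p) has_real_derivative 1 - 0) (at x)" by (intro derivative_intros)
    from DERIV_chain2[OF ac_with_has_deriv[OF ac c0] this] show ?thesis by simp
  qed
  have d: "(\<phi> has_real_derivative (\<eta> (x - a) - \<eta> (x - b))) (at x)" for x
    unfolding \<phi>_def by (intro DERIV_diff dG)
  then have deq: "deriv \<phi> = (\<lambda>x. \<eta> (x - a) - \<eta> (x - b))" by (auto intro: DERIV_imp_deriv)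
  have "deriv \<phi> \<in> bumps \<epsilon> l"
    using bumps.add[OF mem[of a] bumps.scale[OF mem[of b], of "-1"]] by (simp add: deq)
  then have "(deriv ^^ n) (deriv \<phi>) differentiable at x" for n x
    by (intro has_deriv_closed_imp_iterated_differentiable[of "bumps \<epsilon> l"] bumps_has_deriv assms(1))
  moreover have "\<phi> differentiable at x" for x using d real_differentiable_def by blast
  ultimately have "(deriv ^^ n) \<phi> differentiable at x" for n x
    by (cases n) (simp_all add: funpow_Suc_right del: funpow.simps)
  moreover have "bounded {x. \<phi> x \<noteq> 0}"
  proof (rule bounded_subset[OF bounded_closed_interval])
    show "{x. \<phi> x \<noteq> 0} \<subseteq> {- \<bar>a\<bar> - \<bar>b\<bar>..\<bar>a\<bar> + \<bar>b\<bar> + l}"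
    proof (rule ccontr)
      assume "\<not> ?thesis"
      then obtain x where x: "\<phi> x \<noteq> 0" "x < - \<bar>a\<bar> - \<bar>b\<bar> \<or> x > \<bar>a\<bar> + \<bar>b\<bar> + l" by fastforce
      \<comment> \<open>The bump vanishes outside (0, l), so its primitive is constant on either
        side of that interval.\<close>
      have l: "G s = G t" if "s \<le> t" "t \<le> 0 \<or> l \<le> s" for s t
        by (rule ac_with_eq_of_zero[OF ac \<open>s \<le> t\<close>]) (use z that in auto)
      have "x - a \<le> 0 \<and> x - b \<le> 0 \<or> l \<le> x - a \<and> l \<le> x - b" using x(2) by linarith
      then have "G (x - a) = G (x - b)"
        using l[of "x - a" "x - b"] l[of "x - b" "x - a"] linear by metis
      then show False using x(1) by (simp add: \<phi>_def)
    qed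
  qed
  ultimately show ?thesis using deq by (intro that) (auto simp: test_fun_def)
qed

section \<open>The lemma of du Bois-Reymond\<close>

lemma additive_continuous_imp_linear:
  fixes f :: "real \<Rightarrow> real"
  assumes add: "\<And>x y. f (x + y) = f x + f y" and cont: "continuous_on UNIV f"
  shows "f x = x * f 1"
proof -
  have f0: "f 0 = 0" using add[of 0 0] by simp
  have neg: "f (- x) = - f x" for x using add[of x "-x"] f0 by simp
  have nat: "f (real n * x) = real n * f x" for n x
    by (induction n) (auto simp: f0 add algebra_simps)
  have int: "f (of_int k * x) = of_int k * f x" for k x
    by (cases k rule: int_cases2) (simp_all add: nat neg)
  have rat: "f x = x * f 1" if q: "x \<in> \<rat>" for x
  proof -
    obtain k m where x: "x = of_int k / of_int m" "m > 0"
      using q by (metis Rats_cases' )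
    have "of_int m * f x = f (of_int m * x)" by (rule int[symmetric])
    also have "\<dots> = of_int k * f 1" using x int[of k 1] by simp
    finally have "f x = of_int k * f 1 / of_int m" using x(2) by (simp add: field_simps)
    then show ?thesis using x(1) by simp
  qed
  \<comment> \<open>The identity passes from the rationals to their closure because both sides are
    continuous.\<close>
  have "closed {x. f x = x * f 1}"
    by (intro closed_Collect_eq continuous_intros cont)
  then have "closure \<rat> \<subseteq> {x. f x = x * f 1}" using rat by (intro closure_minimal) blast+
  then show ?thesis unfolding Rats_closure_real by blast
qed

text \<open>On a bounded interval the positive and negative parts of \<open>u\<close> are densities
  of finite measures that agree on all half-lines; so the measures coincide, and with them the
  densities almost everywhere.\<close>

lemma loc_integrable_zero_integrals_imp_AE_zero:
  assumes u: "loc_integrable u" and 0: "\<And>a b. a \<le> b \<Longrightarrow> integral {a..b} u = 0"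
  shows "AE x in lborel. u x = 0"
proof -
  have [measurable]: "u \<in> borel_measurable borel" by (rule loc_integrable_measurable[OF u])
  have "AE x in lborel. x \<in> {- real n..real n} \<longrightarrow> u x = 0" for n
  proof -
    let ?I = "indicat_real {- real n..real n}"
    let ?p = "\<lambda>x. ennreal (?I x * u x)" and ?m = "\<lambda>x. ennreal (- (?I x * u x))"
    have int: "integrable lborel (\<lambda>x. indicator {a..b} x * u x)" for a b
      using loc_integrableD[OF u, of a b] by (simp add: set_integrable_def)
    have deq: "density lborel ?p = density lborel ?m"
    proof (rule measure_eqI_lessThan)
      fix x :: real
      have e: "?I t * indicator {x<..} t * u t = indicator {max (- real n) x..real n} t * u t" if "t \<noteq> x" for t
        using that by (auto simp: indicator_def)
      have ix: "integrable lborel (\<lambda>t. ?I t * indicator {x<..} t * u t)"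
        by (rule Bochner_Integration.integrable_bound[OF int[of "- real n" "real n"]])
          (auto simp: indicator_def)
      have "(LINT t|lborel. ?I t * indicator {x<..} t * u t) = (LINT t:{max (- real n) x..real n}|lborel. u t)"
        unfolding set_lebesgue_integral_def
        by (rule integral_cong_AE) (use AE_lborel_singleton[of x] e in auto)
      also have "\<dots> = 0"
      proof (cases "max (- real n) x \<le> real n")
        case True
        then show ?thesis by (simp only: loc_integrable_integral_eq[OF u] 0)
      next
        case False
        then have "{max (- real n) x..real n} = {}" by simp
        then show ?thesis by (simp only: set_lebesgue_integral_def) simp
      qed
      finally have i0: "(LINT t|lborel. ?I t * indicator {x<..} t * u t) = 0" .
      have p: "emeasure (density lborel ?p) {x<..} = (\<integral>\<^sup>+t. ennreal (?I t * indicator {x<..} t * u t) \<partial>lborel)"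
        by (subst emeasure_density) (auto intro!: nn_integral_cong simp: indicator_def)
      have m: "emeasure (density lborel ?m) {x<..} = (\<integral>\<^sup>+t. ennreal (- (?I t * indicator {x<..} t * u t)) \<partial>lborel)"
        by (subst emeasure_density) (auto intro!: nn_integral_cong simp: indicator_def)
      have fin: "(\<integral>\<^sup>+t. ennreal (?I t * indicator {x<..} t * u t) \<partial>lborel) < \<infinity>"
         "(\<integral>\<^sup>+t. ennreal (- (?I t * indicator {x<..} t * u t)) \<partial>lborel) < \<infinity>"
        using ix by (auto simp: real_integrable_def less_top)
      show "emeasure (density lborel ?p) {x<..} < \<infinity>" using fin p by simp
      show "emeasure (density lborel ?p) {x<..} = emeasure (density lborel ?m) {x<..}"
      proof -
        have "enn2real (emeasure (density lborel ?p) {x<..}) = enn2real (emeasure (density lborel ?m) {x<..})"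
          using real_lebesgue_integral_def[OF ix] i0 unfolding p m by simp
        then have "ennreal (enn2real (emeasure (density lborel ?p) {x<..})) =
            ennreal (enn2real (emeasure (density lborel ?m) {x<..}))" by simp
        then show ?thesis using fin unfolding p m by (simp only: ennreal_enn2real infinity_ennreal_def)
      qed
    qed auto
    have "AE x in lborel. ?p x = ?m x"
      by (rule sigma_finite_measure.density_unique[OF lborel.sigma_finite_measure_axioms _ _ deq]) measurable
    then show ?thesis
    proof eventually_elim
      case (elim x)
      \<comment> \<open>\<open>ennreal\<close> sends negative numbers to 0, so the positive and the
        negative part are equal only if both vanish.\<close>
      have "v = 0" if "ennreal v = ennreal (- v)" for v
        using that by (cases "0 \<le> v") (auto simp: ennreal_neg)
      from this[OF elim] show ?case by (auto simp: indicator_def)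
    qed
  qed
  then have "AE x in lborel. \<forall>n. x \<in> {- real n..real n} \<longrightarrow> u x = 0"
    unfolding AE_all_countable by blast
  then show ?thesis
  proof eventually_elim
    case (elim x)
    obtain n where "\<bar>x\<bar> \<le> real n" using real_arch_simple by blast
    then have "x \<in> {- real n..real n}" by (simp add: abs_le_iff minus_le_iff)
    then show ?case using elim by blast
  qed
qed

text \<open>Testing with differences of bumps shows that the integral of \<open>u\<close> over an
  interval depends only on its length. The primitive of \<open>u\<close> that vanishes at 0 is then
  additive and continuous, hence linear.\<close>

lemma du_Bois_Reymond:
  assumes u: "loc_integrable u"
    and orth: "\<And>\<phi>. test_fun \<phi> \<Longrightarrow> (LINT y|lborel. u y * deriv \<phi> y) = 0"
  obtains C where "AE x in lborel. u x = C"
proof -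
  have um [measurable]: "u \<in> borel_measurable borel" by (rule loc_integrable_measurable[OF u])
  \<comment> \<open>As \<open>n\<close> grows the rate \<open>1 / real (Suc n)\<close> tends to 0
    and these bumps, bounded by 1, converge to the indicator of (0, l).\<close>
  define \<eta> where "\<eta> = (\<lambda>l n x. flat_exp (1 / real (Suc n)) 0 x * flat_exp (1 / real (Suc n)) 0 (l - x))"
  have \<eta>m [measurable]: "\<eta> l n \<in> borel_measurable borel" for l n
    unfolding \<eta>_def flat_exp_def by measurable
  have bound: "\<bar>u x * \<eta> l n (x - a)\<bar> \<le> \<bar>indicator {a..a + l} x * u x\<bar>" for l n x a
    by (auto simp: \<eta>_def flat_exp_def indicator_def abs_mult mult_left_le mult_le_one)
  have int: "integrable lborel (\<lambda>x. indicator {a..b} x * u x)" for a b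
    using loc_integrableD[OF u, of a b] by (simp add: set_integrable_def)
  have int\<eta>: "integrable lborel (\<lambda>x. u x * \<eta> l n (x - a))" for l n a
    by (rule Bochner_Integration.integrable_bound[OF int[of a "a + l"]]) (use bound in auto)
  have lim: "(\<lambda>n. LINT x|lborel. u x * \<eta> l n (x - a)) \<longlonglongrightarrow> integral {a..a + l} u" if "l > 0" for l a
  proof -
    have "(\<lambda>n. LINT x|lborel. u x * \<eta> l n (x - a)) \<longlonglongrightarrow> (LINT x|lborel. indicator {a..a + l} x * u x)"
    proof (rule integral_dominated_convergence[where w="\<lambda>x. \<bar>indicator {a..a + l} x * u x\<bar>"])
      show "integrable lborel (\<lambda>x. \<bar>indicator {a..a + l} x * u x\<bar>)" using int by (intro integrable_abs)
      show "AE x in lborel. (\<lambda>n. u x * \<eta> l n (x - a)) \<longlonglongrightarrow> indicator {a..a + l} x * u x"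
        using AE_lborel_singleton[of a] AE_lborel_singleton[of "a + l"]
      proof eventually_elim
        case (elim x)
        show ?case
        proof (cases "a < x \<and> x < a + l")
          case True
          have "(\<lambda>n. u x * (exp (- (1 / real (Suc n) * inverse (x - a))) *
              exp (- (1 / real (Suc n) * inverse (l - (x - a)))))) \<longlonglongrightarrow>
              u x * (exp (- (0 * inverse (x - a))) * exp (- (0 * inverse (l - (x - a)))))"
            by (intro tendsto_intros LIMSEQ_inverse_real_of_nat[unfolded inverse_eq_divide])
          then show ?thesis using True by (simp add: \<eta>_def flat_exp_def)
        next
          case False
          then have "\<eta> l n (x - a) = 0" for n by (auto simp: \<eta>_def flat_exp_def)
          moreover have "x \<notin> {a..a + l}" using False elim by auto
          ultimately show ?thesis by simp
        qed
      qed
      show "AE x in lborel. norm (u x * \<eta> l n (x - a)) \<le> \<bar>indicator {a..a + l} x * u x\<bar>" for n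
        using bound by auto
    qed (measurable)
    then show ?thesis
      by (simp add: set_lebesgue_integral_def flip: loc_integrable_integral_eq[OF u])
  qed
  have eq: "integral {a..a + l} u = integral {b..b + l} u" if l: "l > 0" for a b l
  proof -
    have "(LINT x|lborel. u x * \<eta> l n (x - a)) = (LINT x|lborel. u x * \<eta> l n (x - b))" for n
    proof -
      obtain \<phi> where "test_fun \<phi>" "deriv \<phi> = (\<lambda>x. \<eta> l n (x - a) - \<eta> l n (x - b))"
        unfolding \<eta>_def by (rule test_fun_bump_difference[of "1 / real (Suc n)" l a b]) (use l in auto)
      from orth[OF this(1)] this(2) have "(LINT x|lborel. u x * \<eta> l n (x - a) - u x * \<eta> l n (x - b)) = 0"
        by (simp add: algebra_simps)
      then show ?thesis using Bochner_Integration.integral_diff[OF int\<eta> int\<eta>] by simp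
    qed
    then show ?thesis using lim[OF l, of a] lim[OF l, of b] LIMSEQ_unique by simp
  qed
  define U where "U = (\<lambda>y. if 0 \<le> y then integral {0..y} u else - integral {y..0} u)"
  have acU: "ac_with U u" unfolding U_def by (rule ac_with_indefinite_integral[OF u])
  have iU: "integral {a..b} u = U b - U a" if "a \<le> b" for a b
    using integral_unique[OF ac_withD[OF acU that]] .
  have U0: "U 0 = 0" by (simp add: U_def)
  have pos: "U (a + l) = U a + U l" if "l > 0" for a l
    using eq[OF that, of a 0] iU[of a "a + l"] iU[of 0 l] U0 that by simp
  have "U (x + y) = U x + U y" for x y
    \<comment> \<open>The shift identity is known for positive lengths only; a negative
      \<open>y\<close> is reached by undoing a shift by \<open>- y\<close>.\<close>
    using pos[of y x] pos[of "- y" "x + y"] pos[of "-y" y] U0 by (cases y "0 :: real" rule: linorder_cases) auto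
  then have lin: "U x = x * U 1" for x
    by (rule additive_continuous_imp_linear) (rule ac_with_continuous[OF acU])
  have "AE x in lborel. u x - U 1 = 0"
  proof (rule loc_integrable_zero_integrals_imp_AE_zero)
    show "loc_integrable (\<lambda>x. u x - U 1)" by (rule loc_integrable_diff[OF u loc_integrable_continuous]) auto
    show "integral {a..b} (\<lambda>x. u x - U 1) = 0" if "a \<le> b" for a b
    proof -
      have "integral {a..b} (\<lambda>x. u x - U 1) = integral {a..b} u - integral {a..b} (\<lambda>x. U 1)"
        by (intro integral_diff loc_integrable_integrable_on[OF u] integrable_const_ivl)
      then show ?thesis using that iU[OF that] lin[of a] lin[of b] by (simp add: algebra_simps)
    qed
  qed
  then show ?thesis by (intro that[of "U 1"]) simp
qed

text \<open>The difference of \<open>\<psi>\<close> and a primitive of \<open>g\<close> has weak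
  derivative zero, so it is constant almost everywhere; the constant is absorbed into the
  primitive.\<close>

lemma weak_deriv_imp_ac_with:
  assumes wd: "weak_deriv \<psi> g"
  obtains \<psi>' where "ac_with \<psi>' g" "AE x in lborel. \<psi> x = \<psi>' x"
proof -
  have l: "loc_integrable \<psi>" "loc_integrable g" using wd by (auto simp: weak_deriv_def)
  obtain v where v: "ac_with v g" using ac_with_indefinite_integral[OF l(2)] by blast
  have wv: "weak_deriv v g" by (rule ac_with_imp_weak_deriv[OF v])
  have lv: "loc_integrable v" using wv by (simp add: weak_deriv_def)
  obtain C where C: "AE x in lborel. \<psi> x - v x = C"
  proof (rule du_Bois_Reymond)
    show "loc_integrable (\<lambda>x. \<psi> x - v x)" by (rule loc_integrable_diff[OF l(1) lv])
    fix \<phi> assume t: "test_fun \<phi>"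
    obtain R where R: "\<And>x. R \<le> \<bar>x\<bar> \<Longrightarrow> deriv \<phi> x = 0" using test_fun_support[OF t] by metis
    obtain B where B: "\<And>x. x \<in> {-R..R} \<Longrightarrow> \<bar>deriv \<phi> x\<bar> \<le> B"
      using compact_continuous_image[OF continuous_on_subset[OF test_fun_deriv_continuous[OF t], of "{-R..R}"]]
      by (force dest!: compact_imp_bounded simp: bounded_iff)
    have [measurable]: "deriv \<phi> \<in> borel_measurable borel"
      by (rule borel_measurable_continuous_onI[OF test_fun_deriv_continuous[OF t]])
    have i: "integrable lborel (\<lambda>x. f x * deriv \<phi> x)" if f: "loc_integrable f" for f
    proof (rule Bochner_Integration.integrable_bound)
      show "integrable lborel (\<lambda>x. B * (indicator {-R..R} x * f x))"
        using loc_integrableD[OF f, of "-R" R] by (simp add: set_integrable_def)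
      have [measurable]: "f \<in> borel_measurable borel" by (rule loc_integrable_measurable[OF f])
      show "(\<lambda>x. f x * deriv \<phi> x) \<in> borel_measurable lborel" by measurable
      have "\<bar>f x * deriv \<phi> x\<bar> \<le> \<bar>B * (indicator {-R..R} x * f x)\<bar>" for x
      proof (cases "x \<in> {-R..R}")
        case True
        then have "\<bar>deriv \<phi> x\<bar> \<le> \<bar>B\<bar>" using B[of x] by linarith
        then show ?thesis using True by (simp add: abs_mult mult_left_mono mult.commute[of "\<bar>B\<bar>"])
      next
        case False
        then have "deriv \<phi> x = 0" by (intro R) auto
        then show ?thesis by simp
      qed
      then show "AE x in lborel. norm (f x * deriv \<phi> x) \<le> norm (B * (indicat_real {- R..R} x * f x))"
        by simp
    qed
    have "(LINT y|lborel. \<psi> y * deriv \<phi> y) = (LINT y|lborel. v y * deriv \<phi> y)"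
      using wd wv t by (simp add: weak_deriv_def)
    then show "(LINT y|lborel. (\<psi> y - v y) * deriv \<phi> y) = 0"
      using Bochner_Integration.integral_diff[OF i[OF l(1)] i[OF lv]] by (simp add: left_diff_distrib)
  qed
  have "ac_with (\<lambda>x. v x + C) g" using v by (simp add: ac_with_def)
  moreover have "AE x in lborel. \<psi> x = v x + C" using C by eventually_elim simp
  ultimately show ?thesis by (rule that)
qed

section \<open>Surgery on profiles\<close>

lemma nn_integral_split_at:
  fixes D :: "real \<Rightarrow> ennreal"
  assumes "D \<in> borel_measurable borel"
  shows "(\<integral>\<^sup>+y. D y \<partial>lborel) = (\<integral>\<^sup>+y. D y * indicator {..a} y \<partial>lborel) + (\<integral>\<^sup>+y. D y * indicator {a<..} y \<partial>lborel)"
  using assms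
  by (subst nn_integral_add[symmetric]) (auto intro!: nn_integral_cong simp: indicator_def)

lemma nn_integral_shift:
  fixes D :: "real \<Rightarrow> ennreal"
  assumes [measurable]: "D \<in> borel_measurable borel"
  shows "(\<integral>\<^sup>+y. D (y + d) * indicator {a<..} y \<partial>lborel) = (\<integral>\<^sup>+y. D y * indicator {a + d<..} y \<partial>lborel)"
  by (subst nn_integral_real_affine[of _ 1 d]) (auto simp: indicator_def add.commute intro!: nn_integral_cong)

lemma nn_integral_insert_const:
  fixes D :: "real \<Rightarrow> ennreal"
  assumes [measurable]: "D \<in> borel_measurable borel" and "l \<ge> 0"
  shows "(\<integral>\<^sup>+y. (if y \<le> a then D y else if y \<le> a + l then k else D (y + - l)) \<partial>lborel)
     = (\<integral>\<^sup>+y. D y \<partial>lborel) + k * ennreal l"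
proof -
  have "(\<integral>\<^sup>+y. (if y \<le> a then D y else if y \<le> a + l then k else D (y + - l)) \<partial>lborel) =
     (\<integral>\<^sup>+y. (D y * indicator {..a} y + k * indicator {a<..a + l} y) + D (y + - l) * indicator {a + l<..} y \<partial>lborel)"
    using assms(2) by (intro nn_integral_cong) (auto simp: indicator_def)
  also have "\<dots> = (\<integral>\<^sup>+y. D y * indicator {..a} y \<partial>lborel) + k * ennreal l +
      (\<integral>\<^sup>+y. D (y + - l) * indicator {a + l<..} y \<partial>lborel)"
    using assms(2) by (simp add: nn_integral_add nn_integral_cmult_indicator)
  also have "(\<integral>\<^sup>+y. D (y + - l) * indicator {a + l<..} y \<partial>lborel) = (\<integral>\<^sup>+y. D y * indicator {a<..} y \<partial>lborel)"
    by (subst nn_integral_shift) auto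
  finally show ?thesis by (simp add: nn_integral_split_at[OF assms(1), of a] add_ac)
qed

lemma nn_integral_cut:
  fixes D :: "real \<Rightarrow> ennreal"
  assumes [measurable]: "D \<in> borel_measurable borel" and "a \<le> b"
  shows "(\<integral>\<^sup>+y. (if y \<le> a then D y else D (y + (b - a))) \<partial>lborel) + (\<integral>\<^sup>+y. D y * indicator {a<..b} y \<partial>lborel)
     = (\<integral>\<^sup>+y. D y \<partial>lborel)"
proof -
  have "(\<integral>\<^sup>+y. (if y \<le> a then D y else D (y + (b - a))) \<partial>lborel) =
     (\<integral>\<^sup>+y. D y * indicator {..a} y + D (y + (b - a)) * indicator {a<..} y \<partial>lborel)"
    by (intro nn_integral_cong) (auto simp: indicator_def)
  also have "\<dots> = (\<integral>\<^sup>+y. D y * indicator {..a} y \<partial>lborel) + (\<integral>\<^sup>+y. D (y + (b - a)) * indicator {a<..} y \<partial>lborel)"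
    by (simp add: nn_integral_add)
  also have "(\<integral>\<^sup>+y. D (y + (b - a)) * indicator {a<..} y \<partial>lborel) = (\<integral>\<^sup>+y. D y * indicator {b<..} y \<partial>lborel)"
    by (subst nn_integral_shift) auto
  finally have 1: "(\<integral>\<^sup>+y. (if y \<le> a then D y else D (y + (b - a))) \<partial>lborel) =
     (\<integral>\<^sup>+y. D y * indicator {..a} y \<partial>lborel) + (\<integral>\<^sup>+y. D y * indicator {b<..} y \<partial>lborel)" .
  have "(\<integral>\<^sup>+y. D y * indicator {a<..} y \<partial>lborel) =
     (\<integral>\<^sup>+y. D y * indicator {b<..} y + D y * indicator {a<..b} y \<partial>lborel)"
    using assms(2) by (intro nn_integral_cong) (auto simp: indicator_def)
  also have "\<dots> = (\<integral>\<^sup>+y. D y * indicator {b<..} y \<partial>lborel) + (\<integral>\<^sup>+y. D y * indicator {a<..b} y \<partial>lborel)"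
    by (simp add: nn_integral_add)
  finally show ?thesis unfolding 1 nn_integral_split_at[OF assms(1), of a] by (simp add: add.assoc)
qed

lemma ennreal_le_diff_of_add_le:
  assumes "X + ennreal r \<le> ennreal e" "r \<ge> 0" shows "X \<le> ennreal (e - r)"
proof -
  have "X < top" using assms(1) by (metis ennreal_less_top le_iff_add order_le_less_trans)
  then obtain x where x: "x \<ge> 0" "X = ennreal x" by (cases X) auto
  with assms have "ennreal (x + r) \<le> ennreal e" by simp
  \<comment> \<open>The second alternative covers a negative \<open>e\<close>, for which
    \<open>ennreal e\<close> is 0.\<close>
  then have "x + r \<le> e \<or> x + r \<le> 0"
    by (metis ennreal_eq_0_iff ennreal_le_iff linear le_zero_eq ennreal_neg)
  then show ?thesis using x assms by (auto simp: ennreal_leI ennreal_neg)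
qed

lemma ennreal_eq_diff_of_add_eq:
  assumes "X + ennreal r = ennreal w" "r \<ge> 0" "w \<ge> 0" shows "X = ennreal (w - r)" "r \<le> w"
proof -
  have "X < top" using assms(1) by (metis ennreal_less_top le_iff_add order_le_less_trans)
  then obtain x where x: "x \<ge> 0" "X = ennreal x" by (cases X) auto
  with assms have "ennreal (x + r) = ennreal w" by simp
  then have "x + r = w" using x assms by (subst (asm) ennreal_inj) auto
  then show "X = ennreal (w - r)" "r \<le> w" using x by auto
qed

section \<open>Competitors and the reduction of \<open>tau\<close> to them\<close>

definition energy_density :: "(real \<Rightarrow> real) \<Rightarrow> real \<Rightarrow> real \<Rightarrow> ennreal" where
  "energy_density z p q = ennreal (q\<^sup>2 / 2 + c_of z p)"

text \<open>The energy is bounded by \<open>e\<close> rather than equal to it, since only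
  near-minimizers are used and surgery yields inequalities. The signs of \<open>w\<close> and
  \<open>e\<close> are recorded because \<open>ennreal\<close> sends negative numbers to 0.\<close>

definition competitor :: "(real \<Rightarrow> real) \<Rightarrow> (real \<Rightarrow> real) \<Rightarrow> (real \<Rightarrow> real) \<Rightarrow> real \<Rightarrow> real \<Rightarrow> bool" where
  "competitor z \<psi> g w e \<longleftrightarrow> ac_with \<psi> g \<and> (\<forall>y. 0 \<le> \<psi> y) \<and> 0 \<le> w \<and> 0 \<le> e \<and>
     (\<integral>\<^sup>+y. ennreal (\<psi> y) \<partial>lborel) = ennreal w \<and>
     (\<integral>\<^sup>+y. energy_density z (\<psi> y) (g y) \<partial>lborel) \<le> ennreal e"

lemma competitor_tau_le:
  assumes "competitor z \<psi> g w e" shows "tau z w \<le> ereal e"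
proof -
  have c: "ac_with \<psi> g" "\<And>y. 0 \<le> \<psi> y" "0 \<le> e" "(\<integral>\<^sup>+y. ennreal (\<psi> y) \<partial>lborel) = ennreal w"
    "(\<integral>\<^sup>+y. energy_density z (\<psi> y) (g y) \<partial>lborel) \<le> ennreal e"
    using assms by (auto simp: competitor_def)
  have "energy (c_of z) \<psi> \<le> (\<integral>\<^sup>+y. ennreal (\<bar>g y\<bar>\<^sup>2 / 2 + c_of z \<bar>\<psi> y\<bar>) \<partial>lborel)"
    unfolding energy_def by (rule INF_lower) (simp add: ac_with_imp_weak_deriv[OF c(1)])
  also have "\<dots> \<le> ennreal e" using c by (simp add: energy_density_def)
  finally have "(INF \<psi>\<in>{\<psi>. (\<forall>y. \<psi> y \<ge> 0) \<and> (\<integral>\<^sup>+ y. ennreal (\<psi> y) \<partial>lborel) = ennreal w}. energy (c_of z) \<psi>) \<le> ennreal e"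
    using c by (intro INF_lower2[of \<psi>]) auto
  then have "tau z w \<le> enn2ereal (ennreal e)"
    unfolding tau_def by (simp only: less_eq_ennreal.rep_eq)
  then show ?thesis using c by simp
qed

lemma tau_nonneg: "0 \<le> tau z w"
  by (simp add: tau_def)

text \<open>Passing to the absolutely continuous representative changes neither mass nor
  energy.\<close>

lemma tau_less_competitor:
  assumes "tau z w < ereal e" "0 \<le> w" obtains \<psi> g where "competitor z \<psi> g w e"
proof -
  have e: "0 < e" using assms(1) tau_nonneg[of z w] by (metis ereal_less(2) order_le_less_trans)
  then have "enn2ereal (ennreal e) = ereal e" by simp
  with assms(1) have "(INF \<psi>\<in>{\<psi>. (\<forall>y. \<psi> y \<ge> 0) \<and> (\<integral>\<^sup>+ y. ennreal (\<psi> y) \<partial>lborel) = ennreal w}. energy (c_of z) \<psi>) < ennreal e"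
    unfolding tau_def less_ennreal.rep_eq by metis
  then obtain \<psi> where \<psi>: "\<And>y. \<psi> y \<ge> 0" "(\<integral>\<^sup>+ y. ennreal (\<psi> y) \<partial>lborel) = ennreal w" "energy (c_of z) \<psi> < ennreal e"
    unfolding INF_less_iff by auto
  from \<psi>(3) obtain g where g: "weak_deriv \<psi> g" "(\<integral>\<^sup>+y. ennreal (\<bar>g y\<bar>\<^sup>2 / 2 + c_of z \<bar>\<psi> y\<bar>) \<partial>lborel) < ennreal e"
    unfolding energy_def INF_less_iff by auto
  obtain \<psi>' where \<psi>': "ac_with \<psi>' g" "AE x in lborel. \<psi> x = \<psi>' x"
    using weak_deriv_imp_ac_with[OF g(1)] by blast
  \<comment> \<open>The representative is nonnegative almost everywhere, and a nonempty open set is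
    not a null set.\<close>
  have nonneg: "0 \<le> \<psi>' y" for y
  proof (rule ccontr)
    assume "\<not> 0 \<le> \<psi>' y"
    moreover have op: "open {x. \<psi>' x < 0}"
      by (intro open_Collect_less ac_with_continuous[OF \<psi>'(1)] continuous_intros)
    moreover have "AE x in lborel. x \<notin> {x. \<psi>' x < 0}"
      using \<psi>'(2) by eventually_elim (use \<psi>(1) in \<open>metis mem_Collect_eq not_less\<close>)
    then have "emeasure lborel {x. \<psi>' x < 0} = 0"
      using op by (subst (asm) AE_iff_null_sets[symmetric]) auto
    then have "{x. \<psi>' x < 0} \<in> null_sets lebesgue"
      using op by (intro null_sets_completionI) auto
    then have "negligible {x. \<psi>' x < 0}" by (simp add: negligible_iff_null_sets)
    moreover have "y \<in> {x. \<psi>' x < 0}" using \<open>\<not> 0 \<le> \<psi>' y\<close> by simp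
    ultimately show False using open_not_negligible[OF op] by blast
  qed
  have "(\<integral>\<^sup>+ y. ennreal (\<psi>' y) \<partial>lborel) = ennreal w"
    unfolding \<psi>(2)[symmetric] by (rule nn_integral_cong_AE) (use \<psi>'(2) in \<open>auto elim!: eventually_mono\<close>)
  moreover have "(\<integral>\<^sup>+y. energy_density z (\<psi>' y) (g y) \<partial>lborel) = (\<integral>\<^sup>+y. ennreal (\<bar>g y\<bar>\<^sup>2 / 2 + c_of z \<bar>\<psi> y\<bar>) \<partial>lborel)"
    by (rule nn_integral_cong_AE) (use \<psi>'(2) nonneg in \<open>auto elim!: eventually_mono simp: energy_density_def\<close>)
  ultimately have "competitor z \<psi>' g w e"
    using \<psi>'(1) nonneg assms(2) e g(2) by (simp add: competitor_def)
  then show ?thesis by (rule that)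
qed

lemma tau_zero: "tau z 0 = 0"
proof (rule antisym)
  have "competitor z (\<lambda>_. 0) (\<lambda>_. 0) 0 0"
    by (simp add: competitor_def ac_with_const energy_density_def c_of_def)
  from competitor_tau_le[OF this] show "tau z 0 \<le> 0" by (simp add: zero_ereal_def)
qed (rule tau_nonneg)

text \<open>Serves as a new coordinate on the line, in which removing mass \<open>h\<close>
  corresponds to a shift by \<open>h\<close>.\<close>

definition cum_mass :: "(real \<Rightarrow> real) \<Rightarrow> real \<Rightarrow> real" where
  "cum_mass \<psi> y = (LINT t|lborel. indicator {..y} t * \<psi> t)"

section \<open>Inserting, removing and scaling mass\<close>

locale nonincreasing_rate =
  fixes z :: "real \<Rightarrow> real"
  assumes z_nonneg: "\<And>\<phi>. \<phi> > 0 \<Longrightarrow> z \<phi> \<ge> 0"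
    and z_noninc: "\<And>\<phi> s. 0 < \<phi> \<Longrightarrow> \<phi> \<le> s \<Longrightarrow> z s \<le> z \<phi>"
begin

lemma c_of_nonneg: "0 \<le> c_of z p"
  by (simp add: c_of_def z_nonneg)

lemma c_of_ge: "0 \<le> p \<Longrightarrow> p \<le> m \<Longrightarrow> z m * p \<le> c_of z p"
  by (auto simp: c_of_def z_noninc mult_right_mono)

text \<open>\<open>z\<close> may be discontinuous, but it is monotone on the positive half-line and
  therefore Borel there.\<close>

lemma c_of_measurable [measurable]: "c_of z \<in> borel_measurable borel"
proof -
  have "mono_on {0<..} (\<lambda>x. - z x)" by (rule mono_onI) (simp add: z_noninc)
  then have "(\<lambda>x. - z x) \<in> borel_measurable (restrict_space borel {0<..})"
    by (rule borel_measurable_mono_on_fnc)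
  then have "(\<lambda>x. - (- z x)) \<in> borel_measurable (restrict_space borel {0<..})"
    by (rule borel_measurable_uminus)
  then have "(\<lambda>x. indicator {0<..} x * z x) \<in> borel_measurable borel"
    by (subst (asm) borel_measurable_restrict_space_iff) auto
  then have "(\<lambda>x. (indicator {0<..} x * z x) * x) \<in> borel_measurable borel" by measurable
  also have "(\<lambda>x. (indicator {0<..} x * z x) * x) = c_of z" by (auto simp: c_of_def indicator_def)
  finally show ?thesis .
qed

lemma competitor_measurable:
  assumes "competitor z \<psi> g w e"
  shows "\<psi> \<in> borel_measurable borel" "g \<in> borel_measurable borel"
    "(\<lambda>y. energy_density z (\<psi> y) (g y)) \<in> borel_measurable borel"
proof -
  have ac: "ac_with \<psi> g" using assms by (simp add: competitor_def)
  show [measurable]: "\<psi> \<in> borel_measurable borel"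
    by (rule borel_measurable_continuous_onI[OF ac_with_continuous[OF ac]])
  show [measurable]: "g \<in> borel_measurable borel"
    by (rule loc_integrable_measurable[OF ac_with_loc[OF ac]])
  show "(\<lambda>y. energy_density z (\<psi> y) (g y)) \<in> borel_measurable borel"
    unfolding energy_density_def by measurable
qed

text \<open>A plateau at height \<open>\<psi> a\<close> has no gradient energy. Its length
  \<open>h / \<psi> a\<close> makes it carry mass \<open>h\<close>, so its cost is
  \<open>c_of z (\<psi> a) * (h / \<psi> a) = z (\<psi> a) * h\<close>.\<close>

lemma competitor_insert_plateau:
  assumes c: "competitor z \<psi> g w e" and v: "\<psi> a > 0" and h: "h \<ge> 0"
  obtains \<psi>' g' where "competitor z \<psi>' g' (w + h) (e + z (\<psi> a) * h)"
proof -
  note [measurable] = competitor_measurable[OF c]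
  have ac: "ac_with \<psi> g" "\<And>y. 0 \<le> \<psi> y" "0 \<le> w" "0 \<le> e" "(\<integral>\<^sup>+y. ennreal (\<psi> y) \<partial>lborel) = ennreal w"
    "(\<integral>\<^sup>+y. energy_density z (\<psi> y) (g y) \<partial>lborel) \<le> ennreal e"
    using c by (auto simp: competitor_def)
  define l where "l = h / \<psi> a"
  have l: "l \<ge> 0" "\<psi> a * l = h" using v h by (auto simp: l_def)
  define \<psi>' where "\<psi>' y = (if y \<le> a then \<psi> y else if y \<le> a + l then \<psi> a else \<psi> (y + - l))" for y
  define g' where "g' y = (if y \<le> a then g y else if y \<le> a + l then 0 else g (y + - l))" for y
  have "ac_with \<psi>' g'"
    unfolding \<psi>'_def g'_def
    by (intro ac_with_join[OF ac(1) ac_with_join[OF ac_with_const ac_with_shift[OF ac(1)]]])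
      (use l in auto)
  moreover have "(\<integral>\<^sup>+y. ennreal (\<psi>' y) \<partial>lborel) = ennreal (w + h)"
  proof -
    have "(\<integral>\<^sup>+y. ennreal (\<psi>' y) \<partial>lborel) = (\<integral>\<^sup>+y. (if y \<le> a then ennreal (\<psi> y) else
        if y \<le> a + l then ennreal (\<psi> a) else ennreal (\<psi> (y + - l))) \<partial>lborel)"
      by (intro nn_integral_cong) (simp add: \<psi>'_def)
    also have "\<dots> = (\<integral>\<^sup>+y. ennreal (\<psi> y) \<partial>lborel) + ennreal (\<psi> a) * ennreal l"
      using l by (intro nn_integral_insert_const) auto
    finally show ?thesis using ac l h v by (simp flip: ennreal_mult' add: ennreal_plus[symmetric] del: ennreal_plus)
  qed
  moreover have "(\<integral>\<^sup>+y. energy_density z (\<psi>' y) (g' y) \<partial>lborel) \<le> ennreal (e + z (\<psi> a) * h)"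
  proof -
    have "(\<integral>\<^sup>+y. energy_density z (\<psi>' y) (g' y) \<partial>lborel) = (\<integral>\<^sup>+y. (if y \<le> a then energy_density z (\<psi> y) (g y) else
        if y \<le> a + l then ennreal (c_of z (\<psi> a)) else energy_density z (\<psi> (y + - l)) (g (y + - l))) \<partial>lborel)"
      by (intro nn_integral_cong) (simp add: \<psi>'_def g'_def energy_density_def)
    also have "\<dots> = (\<integral>\<^sup>+y. energy_density z (\<psi> y) (g y) \<partial>lborel) + ennreal (c_of z (\<psi> a)) * ennreal l"
      using l by (intro nn_integral_insert_const) auto
    also have "ennreal (c_of z (\<psi> a)) * ennreal l = ennreal (z (\<psi> a) * h)"
    proof -
      have "c_of z (\<psi> a) * l = z (\<psi> a) * h" using l v by (simp add: c_of_def)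
      then show ?thesis using ennreal_mult'[OF c_of_nonneg] by metis
    qed
    also have "(\<integral>\<^sup>+y. energy_density z (\<psi> y) (g y) \<partial>lborel) + ennreal (z (\<psi> a) * h) \<le> ennreal e + ennreal (z (\<psi> a) * h)"
      by (intro add_right_mono ac)
    finally show ?thesis using ac h z_nonneg[OF v] by simp
  qed
  ultimately show ?thesis using ac h z_nonneg[OF v]
    by (intro that[of \<psi>' g']) (auto simp: competitor_def \<psi>'_def)
qed

lemma energy_density_ge:
  assumes "0 \<le> p" "p \<le> m" shows "ennreal (z m * p) \<le> energy_density z p q"
proof -
  have "z m * p \<le> q\<^sup>2 / 2 + c_of z p" using c_of_ge[OF assms] by (simp add: add_increasing)
  then show ?thesis by (simp add: energy_density_def ennreal_leI)
qed

text \<open>Up to height \<open>m\<close> the rate is at least \<open>z m\<close>, so each unit of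
  mass contributes at least \<open>z m\<close> to the energy.\<close>

lemma energy_of_removed_part:
  assumes c: "competitor z \<psi> g w e" and m: "m > 0" "\<And>y. \<psi> y \<le> m" and A: "A \<in> sets borel"
    and h: "(\<integral>\<^sup>+y. ennreal (\<psi> y) * indicator A y \<partial>lborel) = ennreal h"
  shows "ennreal (z m * h) \<le> (\<integral>\<^sup>+y. energy_density z (\<psi> y) (g y) * indicator A y \<partial>lborel)"
proof -
  note [measurable] = competitor_measurable[OF c] A
  have p: "\<And>y. 0 \<le> \<psi> y" using c by (auto simp: competitor_def)
  have "ennreal (z m * h) = ennreal (z m) * (\<integral>\<^sup>+y. ennreal (\<psi> y) * indicator A y \<partial>lborel)"
    using z_nonneg[OF m(1)] by (simp add: h ennreal_mult')
  also have "\<dots> = (\<integral>\<^sup>+y. ennreal (z m) * (ennreal (\<psi> y) * indicator A y) \<partial>lborel)"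
    by (rule nn_integral_cmult[symmetric]) measurable
  also have "\<dots> \<le> (\<integral>\<^sup>+y. energy_density z (\<psi> y) (g y) * indicator A y \<partial>lborel)"
  proof (rule nn_integral_mono)
    fix y
    have "ennreal (z m) * ennreal (\<psi> y) \<le> energy_density z (\<psi> y) (g y)"
      using energy_density_ge[OF p m(2)] z_nonneg[OF m(1)] by (simp add: ennreal_mult')
    then show "ennreal (z m) * (ennreal (\<psi> y) * indicator A y) \<le> energy_density z (\<psi> y) (g y) * indicator A y"
      by (simp add: indicator_def)
  qed
  finally show ?thesis .
qed

text \<open>Common bookkeeping for the three ways of removing mass below: \<open>A\<close> is the
  removed part and \<open>\<psi>'\<close> the profile that remains.\<close>

lemma competitor_remove:
  assumes c: "competitor z \<psi> g w e" and m: "m > 0" "\<And>y. \<psi> y \<le> m" and A: "A \<in> sets borel"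
    and h: "(\<integral>\<^sup>+y. ennreal (\<psi> y) * indicator A y \<partial>lborel) = ennreal h" "h \<ge> 0"
    and ac: "ac_with \<psi>' g'" "\<And>y. 0 \<le> \<psi>' y"
    and mass: "(\<integral>\<^sup>+y. ennreal (\<psi>' y) \<partial>lborel) + (\<integral>\<^sup>+y. ennreal (\<psi> y) * indicator A y \<partial>lborel) =
       (\<integral>\<^sup>+y. ennreal (\<psi> y) \<partial>lborel)"
    and en: "(\<integral>\<^sup>+y. energy_density z (\<psi>' y) (g' y) \<partial>lborel) +
       (\<integral>\<^sup>+y. energy_density z (\<psi> y) (g y) * indicator A y \<partial>lborel) =
       (\<integral>\<^sup>+y. energy_density z (\<psi> y) (g y) \<partial>lborel)"
  shows "tau z (w - h) \<le> ereal (e - z m * h)"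
proof -
  have 0: "0 \<le> w" "(\<integral>\<^sup>+y. ennreal (\<psi> y) \<partial>lborel) = ennreal w" "0 \<le> e"
    "(\<integral>\<^sup>+y. energy_density z (\<psi> y) (g y) \<partial>lborel) \<le> ennreal e"
    using c by (auto simp: competitor_def)
  have zh: "0 \<le> z m * h" using z_nonneg[OF m(1)] h(2) by simp
  have 1: "(\<integral>\<^sup>+y. ennreal (\<psi>' y) \<partial>lborel) = ennreal (w - h)" "h \<le> w"
    using ennreal_eq_diff_of_add_eq[OF mass[unfolded h 0] h(2) 0(1)] by auto
  have "(\<integral>\<^sup>+y. energy_density z (\<psi>' y) (g' y) \<partial>lborel) + ennreal (z m * h) \<le>
      (\<integral>\<^sup>+y. energy_density z (\<psi> y) (g y) \<partial>lborel)"
    unfolding en[symmetric] by (intro add_left_mono energy_of_removed_part[OF c m A h(1)])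
  also note 0(4)
  finally have 2: "(\<integral>\<^sup>+y. energy_density z (\<psi>' y) (g' y) \<partial>lborel) + ennreal (z m * h) \<le> ennreal e" .
  from ennreal_le_diff_of_add_le[OF this zh]
  have 3: "(\<integral>\<^sup>+y. energy_density z (\<psi>' y) (g' y) \<partial>lborel) \<le> ennreal (e - z m * h)" .
  \<comment> \<open>The new competitor needs a nonnegative energy bound.\<close>
  have "ennreal (z m * h) \<le> ennreal e" using 2 by (metis add.commute le_iff_add order_trans)
  then have "z m * h \<le> e" using 0(3) by (simp add: ennreal_le_iff)
  then have "competitor z \<psi>' g' (w - h) (e - z m * h)"
    using 1 3 ac by (simp add: competitor_def)
  then show ?thesis by (rule competitor_tau_le)
qed

text \<open>Equal values at \<open>a\<close> and \<open>b\<close> allow the two outer pieces to be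
  glued continuously once the part between is cut out.\<close>

lemma tau_le_of_chord:
  assumes c: "competitor z \<psi> g w e" and m: "m > 0" "\<And>y. \<psi> y \<le> m"
    and ab: "a \<le> b" "\<psi> a = \<psi> b"
    and h: "(\<integral>\<^sup>+y. ennreal (\<psi> y) * indicator {a<..b} y \<partial>lborel) = ennreal h" "h \<ge> 0"
  shows "tau z (w - h) \<le> ereal (e - z m * h)"
proof (rule competitor_remove[OF c m _ h])
  note [measurable] = competitor_measurable[OF c]
  have ac: "ac_with \<psi> g" "\<And>y. 0 \<le> \<psi> y" using c by (auto simp: competitor_def)
  show "ac_with (\<lambda>y. if y \<le> a then \<psi> y else \<psi> (y + (b - a))) (\<lambda>y. if y \<le> a then g y else g (y + (b - a)))"
    by (intro ac_with_join ac_with_shift ac) (use ab in simp)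
  show "0 \<le> (if y \<le> a then \<psi> y else \<psi> (y + (b - a)))" for y using ac by simp
  show "(\<integral>\<^sup>+y. ennreal (if y \<le> a then \<psi> y else \<psi> (y + (b - a))) \<partial>lborel) +
      (\<integral>\<^sup>+y. ennreal (\<psi> y) * indicator {a<..b} y \<partial>lborel) = (\<integral>\<^sup>+y. ennreal (\<psi> y) \<partial>lborel)"
    using nn_integral_cut[of "\<lambda>y. ennreal (\<psi> y)" a b] ab by (simp add: if_distrib cong: if_cong)
  have eq: "energy_density z (if y \<le> a then \<psi> y else \<psi> (y + (b - a))) (if y \<le> a then g y else g (y + (b - a))) =
     (if y \<le> a then energy_density z (\<psi> y) (g y) else energy_density z (\<psi> (y + (b - a))) (g (y + (b - a))))" for y
    by simp
  show "(\<integral>\<^sup>+y. energy_density z (if y \<le> a then \<psi> y else \<psi> (y + (b - a))) (if y \<le> a then g y else g (y + (b - a))) \<partial>lborel) +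
      (\<integral>\<^sup>+y. energy_density z (\<psi> y) (g y) * indicator {a<..b} y \<partial>lborel) = (\<integral>\<^sup>+y. energy_density z (\<psi> y) (g y) \<partial>lborel)"
    unfolding eq by (rule nn_integral_cut) (use ab in auto)
qed auto

lemma energy_density_0: "energy_density z 0 0 = 0"
  by (simp add: energy_density_def c_of_def)

text \<open>When the mass to be removed sits at an end of the profile, everything beyond a zero is
  replaced by 0.\<close>

lemma tau_le_of_zero_right:
  assumes c: "competitor z \<psi> g w e" and m: "m > 0" "\<And>y. \<psi> y \<le> m" and a: "\<psi> a = 0"
    and h: "(\<integral>\<^sup>+y. ennreal (\<psi> y) * indicator {a<..} y \<partial>lborel) = ennreal h" "h \<ge> 0"
  shows "tau z (w - h) \<le> ereal (e - z m * h)"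
proof (rule competitor_remove[OF c m _ h])
  note [measurable] = competitor_measurable[OF c]
  have ac: "ac_with \<psi> g" "\<And>y. 0 \<le> \<psi> y" using c by (auto simp: competitor_def)
  show "ac_with (\<lambda>y. if y \<le> a then \<psi> y else 0) (\<lambda>y. if y \<le> a then g y else 0)"
    by (intro ac_with_join ac_with_const ac) (use a in simp)
  show "0 \<le> (if y \<le> a then \<psi> y else 0)" for y using ac by simp
  show "(\<integral>\<^sup>+y. ennreal (if y \<le> a then \<psi> y else 0) \<partial>lborel) +
      (\<integral>\<^sup>+y. ennreal (\<psi> y) * indicator {a<..} y \<partial>lborel) = (\<integral>\<^sup>+y. ennreal (\<psi> y) \<partial>lborel)"
    by (subst nn_integral_split_at[of _ a]) (auto intro!: arg_cong2[where f="(+)"] nn_integral_cong simp: indicator_def)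
  show "(\<integral>\<^sup>+y. energy_density z (if y \<le> a then \<psi> y else 0) (if y \<le> a then g y else 0) \<partial>lborel) +
      (\<integral>\<^sup>+y. energy_density z (\<psi> y) (g y) * indicator {a<..} y \<partial>lborel) = (\<integral>\<^sup>+y. energy_density z (\<psi> y) (g y) \<partial>lborel)"
    by (subst nn_integral_split_at[of "\<lambda>y. energy_density z (\<psi> y) (g y)" a])
      (auto intro!: arg_cong2[where f="(+)"] nn_integral_cong simp: indicator_def energy_density_0)
qed auto

lemma tau_le_of_zero_left:
  assumes c: "competitor z \<psi> g w e" and m: "m > 0" "\<And>y. \<psi> y \<le> m" and a: "\<psi> a = 0"
    and h: "(\<integral>\<^sup>+y. ennreal (\<psi> y) * indicator {..a} y \<partial>lborel) = ennreal h" "h \<ge> 0"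
  shows "tau z (w - h) \<le> ereal (e - z m * h)"
proof (rule competitor_remove[OF c m _ h])
  note [measurable] = competitor_measurable[OF c]
  have ac: "ac_with \<psi> g" "\<And>y. 0 \<le> \<psi> y" using c by (auto simp: competitor_def)
  show "ac_with (\<lambda>y. if y \<le> a then 0 else \<psi> y) (\<lambda>y. if y \<le> a then 0 else g y)"
    by (intro ac_with_join ac_with_const ac) (use a in simp)
  show "0 \<le> (if y \<le> a then 0 else \<psi> y)" for y using ac by simp
  show "(\<integral>\<^sup>+y. ennreal (if y \<le> a then 0 else \<psi> y) \<partial>lborel) +
      (\<integral>\<^sup>+y. ennreal (\<psi> y) * indicator {..a} y \<partial>lborel) = (\<integral>\<^sup>+y. ennreal (\<psi> y) \<partial>lborel)"
    by (subst nn_integral_split_at[of "\<lambda>y. ennreal (\<psi> y)" a], simp, subst add.commute)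
      (auto intro!: arg_cong2[where f="(+)"] nn_integral_cong simp: indicator_def)
  show "(\<integral>\<^sup>+y. energy_density z (if y \<le> a then 0 else \<psi> y) (if y \<le> a then 0 else g y) \<partial>lborel) +
      (\<integral>\<^sup>+y. energy_density z (\<psi> y) (g y) * indicator {..a} y \<partial>lborel) = (\<integral>\<^sup>+y. energy_density z (\<psi> y) (g y) \<partial>lborel)"
    by (subst nn_integral_split_at[of "\<lambda>y. energy_density z (\<psi> y) (g y)" a], simp, subst add.commute)
      (auto intro!: arg_cong2[where f="(+)"] nn_integral_cong simp: indicator_def energy_density_0)
qed auto

text \<open>The gradient term scales by k^2, and \<open>c_of z\<close> grows by at most the factor
  \<open>k\<close> because \<open>z\<close> is nonincreasing; k \<ge> 1 gives the common factor
  k^2.\<close>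

lemma competitor_scale:
  assumes c: "competitor z \<psi> g w e" and k: "k \<ge> 1"
  shows "competitor z (\<lambda>y. k * \<psi> y) (\<lambda>y. k * g y) (k * w) (k\<^sup>2 * e)"
proof -
  note [measurable] = competitor_measurable[OF c]
  have ac: "ac_with \<psi> g" "\<And>y. 0 \<le> \<psi> y" "0 \<le> w" "0 \<le> e" "(\<integral>\<^sup>+y. ennreal (\<psi> y) \<partial>lborel) = ennreal w"
    "(\<integral>\<^sup>+y. energy_density z (\<psi> y) (g y) \<partial>lborel) \<le> ennreal e"
    using c by (auto simp: competitor_def)
  have c_le: "c_of z (k * p) \<le> k\<^sup>2 * c_of z p" if "0 \<le> p" for p
  proof (cases "p = 0")
    case False
    then have "p > 0" using that by simp
    have "z (k * p) * (k * p) \<le> z p * (k * p)"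
      using k \<open>p > 0\<close> by (intro mult_right_mono z_noninc) auto
    also have "\<dots> = k * (z p * p)" by simp
    also have "\<dots> \<le> k\<^sup>2 * (z p * p)"
      using k z_nonneg[OF \<open>p > 0\<close>] \<open>p > 0\<close> by (intro mult_right_mono) (auto simp: power2_eq_square)
    finally show ?thesis using k \<open>p > 0\<close> by (simp add: c_of_def)
  qed (simp add: c_of_def)
  have le: "energy_density z (k * \<psi> y) (k * g y) \<le> ennreal (k\<^sup>2) * energy_density z (\<psi> y) (g y)" for y
  proof -
    have "(k * g y)\<^sup>2 / 2 + c_of z (k * \<psi> y) \<le> k\<^sup>2 * ((g y)\<^sup>2 / 2 + c_of z (\<psi> y))"
      using c_le[OF ac(2)[of y]] by (simp add: power_mult_distrib algebra_simps)
    then show ?thesis by (simp add: energy_density_def ennreal_leI flip: ennreal_mult')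
  qed
  have "(\<integral>\<^sup>+y. energy_density z (k * \<psi> y) (k * g y) \<partial>lborel) \<le> (\<integral>\<^sup>+y. ennreal (k\<^sup>2) * energy_density z (\<psi> y) (g y) \<partial>lborel)"
    by (intro nn_integral_mono le)
  also have "\<dots> = ennreal (k\<^sup>2) * (\<integral>\<^sup>+y. energy_density z (\<psi> y) (g y) \<partial>lborel)"
    by (rule nn_integral_cmult) measurable
  also have "\<dots> \<le> ennreal (k\<^sup>2) * ennreal e" by (intro mult_left_mono ac) simp
  finally have 1: "(\<integral>\<^sup>+y. energy_density z (k * \<psi> y) (k * g y) \<partial>lborel) \<le> ennreal (k\<^sup>2 * e)"
    by (simp add: ennreal_mult')
  have "(\<integral>\<^sup>+y. ennreal (k * \<psi> y) \<partial>lborel) = ennreal k * ennreal w"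
    using k by (simp add: ennreal_mult' nn_integral_cmult ac)
  then have "(\<integral>\<^sup>+y. ennreal (k * \<psi> y) \<partial>lborel) = ennreal (k * w)" using k by (simp add: ennreal_mult')
  with 1 show ?thesis using ac k by (simp add: competitor_def ac_with_scale)
qed

section \<open>How the energy controls the oscillation\<close>

lemma competitor_oscillation:
  assumes c: "competitor z \<psi> g w e" and k: "k > 0" and xy: "x \<le> y"
  shows "\<bar>\<psi> y - \<psi> x\<bar> \<le> k * e + (y - x) / (2 * k)"
proof -
  note [measurable] = competitor_measurable[OF c]
  have ac: "ac_with \<psi> g" "0 \<le> e" "(\<integral>\<^sup>+y. energy_density z (\<psi> y) (g y) \<partial>lborel) \<le> ennreal e"
    using c by (auto simp: competitor_def)
  have l: "loc_integrable g" by (rule ac_with_loc[OF ac(1)])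
  have i: "integrable lborel (\<lambda>t. indicator {x..y} t * g t)"
    using loc_integrableD[OF l, of x y] by (simp add: set_integrable_def)
  have "\<psi> y - \<psi> x = (LINT t|lborel. indicator {x..y} t * g t)"
    using loc_integrable_integral_eq[OF l, of x y] integral_unique[OF ac_withD[OF ac(1) xy]]
    by (simp add: set_lebesgue_integral_def)
  then have "ennreal \<bar>\<psi> y - \<psi> x\<bar> \<le> ennreal (LINT t|lborel. \<bar>indicator {x..y} t * g t\<bar>)"
    using integral_abs_bound[of lborel "\<lambda>t. indicator {x..y} t * g t"] by (intro ennreal_leI) (simp only:)
  also have "\<dots> = (\<integral>\<^sup>+t. ennreal \<bar>indicator {x..y} t * g t\<bar> \<partial>lborel)"
    using i by (intro nn_integral_eq_integral[symmetric] integrable_abs) auto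
  also have "\<dots> \<le> (\<integral>\<^sup>+t. ennreal k * energy_density z (\<psi> t) (g t) + ennreal (1 / (2 * k)) * indicator {x..y} t \<partial>lborel)"
  proof (rule nn_integral_mono)
    fix t
    have "\<bar>g t\<bar> \<le> k * ((g t)\<^sup>2 / 2 + c_of z (\<psi> t)) + 1 / (2 * k)"
    proof -
      \<comment> \<open>Young's inequality with a free parameter \<open>k\<close>, in place of
        Cauchy-Schwarz and a square root.\<close>
      have "0 \<le> (k * \<bar>g t\<bar> - 1)\<^sup>2 / (2 * k)" using k by simp
      also have "\<dots> = k * (g t)\<^sup>2 / 2 + 1 / (2 * k) - \<bar>g t\<bar>"
        using k by (simp add: power2_diff field_simps power2_eq_square)
      finally have "\<bar>g t\<bar> \<le> k * (g t)\<^sup>2 / 2 + 1 / (2 * k)" by simp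
      moreover have "0 \<le> k * c_of z (\<psi> t)" using k c_of_nonneg by simp
      ultimately show ?thesis by (simp add: algebra_simps)
    qed
    then have "ennreal \<bar>g t\<bar> \<le> ennreal k * energy_density z (\<psi> t) (g t) + ennreal (1 / (2 * k))"
      using k c_of_nonneg[of "\<psi> t"]
      by (simp add: energy_density_def flip: ennreal_mult' ennreal_plus)
    then show "ennreal \<bar>indicator {x..y} t * g t\<bar> \<le>
        ennreal k * energy_density z (\<psi> t) (g t) + ennreal (1 / (2 * k)) * indicator {x..y} t"
      by (auto simp: indicator_def)
  qed
  also have "\<dots> = ennreal k * (\<integral>\<^sup>+y. energy_density z (\<psi> y) (g y) \<partial>lborel) + ennreal (1 / (2 * k)) * ennreal (y - x)"
    using xy by (simp add: nn_integral_add nn_integral_cmult)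
  also have "\<dots> \<le> ennreal k * ennreal e + ennreal (1 / (2 * k)) * ennreal (y - x)"
    by (intro add_right_mono mult_left_mono ac) simp
  also have "\<dots> = ennreal (k * e + (y - x) / (2 * k))"
    using k ac(2) xy by (simp flip: ennreal_mult' ennreal_plus)
  finally show ?thesis using k ac(2) xy by (subst (asm) ennreal_le_iff) auto
qed

lemma competitor_close:
  assumes c: "competitor z \<psi> g w e" and e: "e > 0" and p: "p > 0" and xy: "\<bar>y - x\<bar> \<le> p\<^sup>2 / (8 * e)"
  shows "\<bar>\<psi> y - \<psi> x\<bar> \<le> p / 2"
proof -
  \<comment> \<open>With this parameter each of the two terms of the oscillation bound is at most p
    / 4.\<close>
  have k: "p / (4 * e) > 0" using e p by simp
  have "\<bar>\<psi> y - \<psi> x\<bar> \<le> p / (4 * e) * e + \<bar>y - x\<bar> / (2 * (p / (4 * e)))"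
    using competitor_oscillation[OF c k, of x y] competitor_oscillation[OF c k, of y x]
    by (cases "x \<le> y") (auto simp: abs_minus_commute)
  also have "\<dots> \<le> p / (4 * e) * e + p\<^sup>2 / (8 * e) / (2 * (p / (4 * e)))"
    using e p xy by (intro add_left_mono divide_right_mono) auto
  also have "\<dots> = p / 2" using e p by (simp add: field_simps power2_eq_square)
  finally show ?thesis .
qed

section \<open>The mass to the left of a point as a coordinate\<close>

lemma competitor_integrable:
  assumes c: "competitor z \<psi> g w e"
  shows "integrable lborel \<psi>" "(LINT t|lborel. \<psi> t) = w"
proof -
  note [measurable] = competitor_measurable[OF c]
  have p: "\<And>y. 0 \<le> \<psi> y" "0 \<le> w" "(\<integral>\<^sup>+y. ennreal (\<psi> y) \<partial>lborel) = ennreal w"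
    using c by (auto simp: competitor_def)
  show "integrable lborel \<psi>" using p by (intro integrableI_nonneg) auto
  show "(LINT t|lborel. \<psi> t) = w" using p by (subst integral_eq_nn_integral) auto
qed

lemma cum_mass_ac:
  assumes c: "competitor z \<psi> g w e"
  shows "ac_with (cum_mass \<psi>) \<psi>"
  unfolding ac_with_def
proof (intro conjI allI impI)
  have ac: "ac_with \<psi> g" using c by (auto simp: competitor_def)
  note [measurable] = competitor_measurable[OF c]
  note int = competitor_integrable(1)[OF c]
  show l: "loc_integrable \<psi>" by (rule loc_integrable_continuous[OF ac_with_continuous[OF ac]])
  have i: "integrable lborel (\<lambda>t. indicator A t * \<psi> t)" if "A \<in> sets borel" for A
    using integrable_mult_indicator[of A lborel \<psi>] int that by simp
  fix x y :: real assume xy: "x \<le> y"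
  have "cum_mass \<psi> y - cum_mass \<psi> x = (LINT t|lborel. indicator {..y} t * \<psi> t - indicator {..x} t * \<psi> t)"
    unfolding cum_mass_def by (rule Bochner_Integration.integral_diff[symmetric]) (auto intro: i)
  also have "\<dots> = (LINT t|lborel. indicator {x..y} t * \<psi> t)"
    by (rule integral_cong_AE) (use AE_lborel_singleton[of x] xy in \<open>auto elim!: eventually_mono simp: indicator_def\<close>)
  also have "\<dots> = integral {x..y} \<psi>"
    using loc_integrable_integral_eq[OF l, of x y] by (simp add: set_lebesgue_integral_def)
  finally show "(\<psi> has_integral (cum_mass \<psi> y - cum_mass \<psi> x)) {x..y}"
    using loc_integrable_integrable_on[OF l, of x y] by (simp add: has_integral_integral)
qed

lemma cum_mass_mono:
  assumes c: "competitor z \<psi> g w e" "x \<le> y" shows "cum_mass \<psi> x \<le> cum_mass \<psi> y"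
proof -
  have "\<And>y. 0 \<le> \<psi> y" using c by (auto simp: competitor_def)
  then show ?thesis using has_integral_nonneg[OF ac_withD[OF cum_mass_ac[OF c(1)] c(2)]] by simp
qed

lemma nn_integral_cum_mass:
  assumes c: "competitor z \<psi> g w e"
  shows "(\<integral>\<^sup>+t. ennreal (\<psi> t) * indicator {..a} t \<partial>lborel) = ennreal (cum_mass \<psi> a)"
    and "(\<integral>\<^sup>+t. ennreal (\<psi> t) * indicator {a<..} t \<partial>lborel) = ennreal (w - cum_mass \<psi> a)"
    and "0 \<le> cum_mass \<psi> a" "cum_mass \<psi> a \<le> w"
    and "a \<le> b \<Longrightarrow> (\<integral>\<^sup>+t. ennreal (\<psi> t) * indicator {a<..b} t \<partial>lborel) = ennreal (cum_mass \<psi> b - cum_mass \<psi> a)"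
proof -
  note [measurable] = competitor_measurable[OF c]
  have p: "\<And>y. 0 \<le> \<psi> y" "0 \<le> w" "(\<integral>\<^sup>+y. ennreal (\<psi> y) \<partial>lborel) = ennreal w"
    using c by (auto simp: competitor_def)
  have i: "integrable lborel (\<lambda>t. indicator A t * \<psi> t)" if "A \<in> sets borel" for A
    using integrable_mult_indicator[of A lborel \<psi>] competitor_integrable(1)[OF c] that by simp
  have cm: "(\<integral>\<^sup>+t. ennreal (\<psi> t) * indicator {..a} t \<partial>lborel) = ennreal (cum_mass \<psi> a)" for a
    unfolding cum_mass_def using p
    by (subst nn_integral_eq_integral[OF i, symmetric]) (auto intro!: nn_integral_cong simp: indicator_def)
  show "(\<integral>\<^sup>+t. ennreal (\<psi> t) * indicator {..a} t \<partial>lborel) = ennreal (cum_mass \<psi> a)" by (rule cm)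
  show nonneg: "0 \<le> cum_mass \<psi> a" for a
    unfolding cum_mass_def using p by (intro Bochner_Integration.integral_nonneg) auto
  have "(\<integral>\<^sup>+t. ennreal (\<psi> t) * indicator {a<..} t \<partial>lborel) + ennreal (cum_mass \<psi> a) = ennreal w"
    using nn_integral_split_at[of "\<lambda>y. ennreal (\<psi> y)" a] p(3) cm[of a] by (simp add: add.commute)
  from ennreal_eq_diff_of_add_eq[OF this nonneg p(2)]
  show "(\<integral>\<^sup>+t. ennreal (\<psi> t) * indicator {a<..} t \<partial>lborel) = ennreal (w - cum_mass \<psi> a)" "cum_mass \<psi> a \<le> w"
    by auto
  assume ab: "a \<le> b"
  have "(\<integral>\<^sup>+t. ennreal (\<psi> t) * indicator {a<..b} t \<partial>lborel) + (\<integral>\<^sup>+t. ennreal (\<psi> t) * indicator {..a} t \<partial>lborel)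
     = (\<integral>\<^sup>+t. ennreal (\<psi> t) * indicator {..b} t \<partial>lborel)"
    using ab by (subst nn_integral_add[symmetric]) (auto intro!: nn_integral_cong simp: indicator_def)
  then have "(\<integral>\<^sup>+t. ennreal (\<psi> t) * indicator {a<..b} t \<partial>lborel) + ennreal (cum_mass \<psi> a) = ennreal (cum_mass \<psi> b)"
    by (simp only: cm)
  from ennreal_eq_diff_of_add_eq(1)[OF this nonneg nonneg]
  show "(\<integral>\<^sup>+t. ennreal (\<psi> t) * indicator {a<..b} t \<partial>lborel) = ennreal (cum_mass \<psi> b - cum_mass \<psi> a)" .
qed

text \<open>Within distance \<open>r\<close> of \<open>x\<close> the profile is at least
  \<open>p / 2\<close>, so either side of \<open>x\<close> carries mass at least
  \<open>r * (p / 2)\<close>, which is \<open>p ^ 3 / (16 * e)\<close>.\<close>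

lemma cum_mass_increase:
  assumes c: "competitor z \<psi> g w e" and e: "e > 0" and p: "p > 0" and x: "\<psi> x \<ge> p"
  defines "r \<equiv> p\<^sup>2 / (8 * e)"
  shows "cum_mass \<psi> (x + r) - cum_mass \<psi> x \<ge> p ^ 3 / (16 * e)"
    "cum_mass \<psi> x - cum_mass \<psi> (x - r) \<ge> p ^ 3 / (16 * e)"
proof -
  have r: "r \<ge> 0" using e by (simp add: r_def)
  have large: "p / 2 \<le> \<psi> t" if "\<bar>t - x\<bar> \<le> r" for t
    using competitor_close[OF c e p that[unfolded r_def]] x by linarith
  have eq: "r * (p / 2) = p ^ 3 / (16 * e)" by (simp add: r_def power2_eq_square power3_eq_cube)
  have le: "r * (p / 2) \<le> cum_mass \<psi> b - cum_mass \<psi> a" if "b - a = r" "\<And>t. t \<in> {a..b} \<Longrightarrow> \<bar>t - x\<bar> \<le> r" for a b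
  proof (rule has_integral_le)
    show "((\<lambda>_. p / 2) has_integral r * (p / 2)) {a..b}"
      using has_integral_const_real[of "p / 2" a b] that r by simp
    show "(\<psi> has_integral (cum_mass \<psi> b - cum_mass \<psi> a)) {a..b}"
      using that r by (intro ac_withD[OF cum_mass_ac[OF c]]) simp
  qed (use large that in auto)
  show "cum_mass \<psi> (x + r) - cum_mass \<psi> x \<ge> p ^ 3 / (16 * e)"
    using le[of "x + r" x] unfolding eq by simp
  show "cum_mass \<psi> x - cum_mass \<psi> (x - r) \<ge> p ^ 3 / (16 * e)"
    using le[of x "x - r"] unfolding eq by simp
qed

lemma cum_mass_of_large_value:
  assumes c: "competitor z \<psi> g w e" and e: "e > 0" and p: "p > 0" and x: "\<psi> x \<ge> p"
  shows "cum_mass \<psi> x \<ge> p ^ 3 / (16 * e)" "w - cum_mass \<psi> x \<ge> p ^ 3 / (16 * e)"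
  using cum_mass_increase[OF c e p x] nn_integral_cum_mass(3,4)[OF c] by (smt (verit))+

text \<open>This makes the profile, as a function of the mass to its left, uniformly continuous.\<close>

lemma cum_mass_separates:
  assumes c: "competitor z \<psi> g w e" and e: "e > 0" and p: "p > 0" and xy: "\<psi> x \<ge> \<psi> y + p"
  shows "\<bar>cum_mass \<psi> x - cum_mass \<psi> y\<bar> \<ge> p ^ 3 / (16 * e)"
proof -
  let ?r = "p\<^sup>2 / (8 * e)"
  have "\<psi> x \<ge> p" using xy c by (auto simp: competitor_def intro: order_trans[rotated])
  note inc = cum_mass_increase[OF c e p this]
  \<comment> \<open>Within distance \<open>?r\<close> values differ by at most p / 2. So
    \<open>y\<close> is farther away, and one of the two intervals of length \<open>?r\<close> next
    to \<open>x\<close> lies between \<open>x\<close> and \<open>y\<close>.\<close>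
  have "\<not> \<bar>y - x\<bar> \<le> ?r"
    using competitor_close[OF c e p, of y x] xy p by linarith
  then have "x + ?r \<le> y \<or> y \<le> x - ?r" by linarith
  then show ?thesis
    using inc cum_mass_mono[OF c, of "x + ?r" y] cum_mass_mono[OF c, of y "x - ?r"] by linarith
qed

lemma cum_mass_limits:
  assumes c: "competitor z \<psi> g w e"
  shows "(cum_mass \<psi> \<longlongrightarrow> w) at_top" "(cum_mass \<psi> \<longlongrightarrow> 0) at_bot"
proof -
  note [measurable] = competitor_measurable[OF c]
  note int = competitor_integrable[OF c]
  have "((\<lambda>y. LINT t|lborel. indicator {..y} t *\<^sub>R \<psi> t) \<longlongrightarrow> (LINT t|lborel. \<psi> t)) at_top"
    by (rule tendsto_integral_at_top) (use int in auto)
  then show "(cum_mass \<psi> \<longlongrightarrow> w) at_top" by (simp add: cum_mass_def[abs_def] int)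
  have "((\<lambda>y. LINT t|lborel. indicator {..- y} t * \<psi> t) \<longlongrightarrow> (LINT (t::real)|lborel. 0)) at_top"
  proof (rule integral_dominated_convergence_at_top[where w = \<psi>])
    have p: "\<And>y. 0 \<le> \<psi> y" using c by (auto simp: competitor_def)
    show "\<forall>\<^sub>F i in at_top. AE x in lborel. norm (indicat_real {..- i} x * \<psi> x) \<le> \<psi> x"
      using p by (auto simp: indicator_def)
    show "AE x in lborel. ((\<lambda>i. indicat_real {..- i} x * \<psi> x) \<longlongrightarrow> 0) at_top"
    proof (rule AE_I2, rule tendsto_eventually)
      fix x :: real
      show "\<forall>\<^sub>F i in at_top. indicat_real {..- i} x * \<psi> x = 0"
        using eventually_gt_at_top[of "- x"] by eventually_elim (auto simp: indicator_def)
    qed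
  qed (use int in auto)
  then have "((\<lambda>y. cum_mass \<psi> (- y)) \<longlongrightarrow> 0) at_top" by (simp add: cum_mass_def)
  then show "(cum_mass \<psi> \<longlongrightarrow> 0) at_bot" by (simp add: filterlim_at_bot_mirror)
qed

lemma cum_mass_surj:
  assumes c: "competitor z \<psi> g w e" and s: "0 < s" "s < w"
  obtains y where "cum_mass \<psi> y = s"
proof -
  obtain b where b: "cum_mass \<psi> b > s"
    using order_tendstoD(1)[OF cum_mass_limits(1)[OF c] s(2)] by (meson eventually_at_top_linorder order_refl)
  obtain a where a: "cum_mass \<psi> a < s"
    using order_tendstoD(2)[OF cum_mass_limits(2)[OF c] s(1)] by (meson eventually_at_bot_linorder order_refl)
  have "a \<le> b" using cum_mass_mono[OF c, of b a] a b by linarith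
  then show ?thesis
    using IVT'[of "cum_mass \<psi>" a s b] a b that
      continuous_on_subset[OF ac_with_continuous[OF cum_mass_ac[OF c]]] by (metis less_imp_le top_greatest)
qed

text \<open>A superlevel set at a positive height is bounded: each of its points has a fixed amount
  of mass on both sides, while the mass to the left tends to 0 and to \<open>w\<close> at the two
  ends. The maximum is attained on this compact set.\<close>

lemma competitor_max:
  assumes c: "competitor z \<psi> g w e" and e: "e > 0" and w: "w > 0"
  obtains y where "\<psi> y > 0" "\<And>x. \<psi> x \<le> \<psi> y"
proof -
  have ac: "ac_with \<psi> g" "\<And>y. 0 \<le> \<psi> y" using c by (auto simp: competitor_def)
  have cont: "continuous_on UNIV \<psi>" by (rule ac_with_continuous[OF ac(1)])
  have "\<exists>y. \<psi> y > 0"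
  proof (rule ccontr)
    assume "\<not> ?thesis"
    then have "\<psi> y = 0" for y using ac(2)[of y] by (simp add: not_less order_antisym)
    then have "\<psi> = (\<lambda>_. 0)" by auto
    then show False using competitor_integrable(2)[OF c] w by simp
  qed
  then obtain y1 where y1: "\<psi> y1 > 0" by blast
  define K where "K = {y. \<psi> y1 \<le> \<psi> y}"
  have d: "\<psi> y1 ^ 3 / (16 * e) > 0" using y1 e by simp
  have "w - \<psi> y1 ^ 3 / (16 * e) < w" using d by simp
  from order_tendstoD(1)[OF cum_mass_limits(1)[OF c] this]
  obtain B where B: "\<And>y. y \<ge> B \<Longrightarrow> cum_mass \<psi> y > w - \<psi> y1 ^ 3 / (16 * e)"
    by (auto simp: eventually_at_top_linorder)
  from order_tendstoD(2)[OF cum_mass_limits(2)[OF c] d]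
  obtain A where A: "\<And>y. y \<le> A \<Longrightarrow> cum_mass \<psi> y < \<psi> y1 ^ 3 / (16 * e)"
    by (auto simp: eventually_at_bot_linorder)
  have "K \<subseteq> {A..B}"
  proof
    fix y assume "y \<in> K"
    then have "\<psi> y \<ge> \<psi> y1" by (simp add: K_def)
    from cum_mass_of_large_value[OF c e y1 this] show "y \<in> {A..B}"
      using A[of y] B[of y] by (auto simp: not_le[symmetric]) (smt (verit))+
  qed
  moreover have "closed K" unfolding K_def by (intro closed_Collect_le continuous_intros cont)
  ultimately have "compact K" using compact_Icc closed_Int_compact by (metis inf.absorb1)
  moreover have "K \<noteq> {}" by (auto simp: K_def)
  ultimately obtain y where y: "y \<in> K" "\<And>x. x \<in> K \<Longrightarrow> \<psi> x \<le> \<psi> y"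
    using continuous_attains_sup[of K \<psi>] continuous_on_subset[OF cont] by blast
  show ?thesis
  proof (rule that)
    show "\<psi> y > 0" using y(1) y1 by (simp add: K_def)
    show "\<psi> x \<le> \<psi> y" for x
    proof (cases "x \<in> K")
      case False
      then have "\<psi> x \<le> \<psi> y1" by (simp add: K_def)
      also have "\<dots> \<le> \<psi> y" using y(1) by (simp add: K_def)
      finally show ?thesis .
    qed (rule y)
  qed
qed

section \<open>Bounds for the transport cost\<close>

lemma tau_decrease:
  assumes c: "competitor z \<psi> g w e" and e: "e > 0" and h: "0 < h" "h < w"
    and m: "m > 0" "\<And>y. \<psi> y \<le> m"
  shows "tau z (w - h) \<le> ereal (e - z m * h)"
proof -
  have nonneg: "0 \<le> \<psi> y" for y using c by (auto simp: competitor_def)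
  \<comment> \<open>An arbitrary point with mass \<open>s\<close> to its left; by
    \<open>cum_mass_separates\<close> the value \<open>\<psi> (Y s)\<close> does not depend on the
    choice.\<close>
  define Y where "Y s = (SOME y. cum_mass \<psi> y = s)" for s
  have Y: "cum_mass \<psi> (Y s) = s" if "0 < s" "s < w" for s
    using cum_mass_surj[OF c that] someI_ex[of "\<lambda>y. cum_mass \<psi> y = s"] unfolding Y_def by blast
  define p where "p s = (if 0 < s \<and> s < w then \<psi> (Y s) else 0)" for s
  have pY: "p s = \<psi> (Y s)" if "0 < s" "s < w" for s using that by (simp add: p_def)
  have p0: "p s = 0" if "\<not> (0 < s \<and> s < w)" for s using that by (auto simp: p_def)
  have p_nonneg: "0 \<le> p s" for s by (simp add: p_def nonneg)
  \<comment> \<open>A modulus of continuity for \<open>p\<close>. At the ends 0 and \<open>w\<close>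
    it holds because a value of at least \<open>r\<close> forces enough mass on both sides of the
    point.\<close>
  have sep: "p s < p t + r" if st: "s \<in> {0..w}" "t \<in> {0..w}" "\<bar>s - t\<bar> < r ^ 3 / (16 * e)" and r: "r > 0" for s t r
  proof (rule ccontr)
    assume "\<not> ?thesis"
    then have ge: "p t + r \<le> p s" by simp
    then have "0 < p s" using p_nonneg[of t] r by linarith
    then have s: "0 < s" "s < w" using p0[of s] by force+
    show False
    proof (cases "0 < t \<and> t < w")
      case True
      then have t: "0 < t" "t < w" by auto
      have "\<psi> (Y t) + r \<le> \<psi> (Y s)" using ge by (simp add: pY s t)
      from cum_mass_separates[OF c e r this] st(3) show False by (simp add: Y s t)
    next
      case False
      then have "t = 0 \<or> t = w" using st(2) by auto
      moreover have "r \<le> \<psi> (Y s)" using ge p0[OF False] by (simp add: pY s)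
      from cum_mass_of_large_value[OF c e r this]
      have "r ^ 3 / (16 * e) \<le> s" "r ^ 3 / (16 * e) \<le> w - s" by (simp_all add: Y s)
      ultimately show False using st(3) s by auto
    qed
  qed
  have cont: "continuous_on {0..w} p"
    unfolding continuous_on_iff
  proof (intro ballI allI impI)
    fix s r :: real assume s: "s \<in> {0..w}" and r: "r > 0"
    show "\<exists>d>0. \<forall>t\<in>{0..w}. dist t s < d \<longrightarrow> dist (p t) (p s) < r"
    proof (intro exI conjI ballI impI)
      show "r ^ 3 / (16 * e) > 0" using r e by simp
      fix t assume "t \<in> {0..w}" "dist t s < r ^ 3 / (16 * e)"
      then show "dist (p t) (p s) < r"
        using sep[of s t r] sep[of t s r] s r by (auto simp: dist_real_def abs_minus_commute)
    qed
  qed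
  \<comment> \<open>The difference is nonnegative at s = 0, where \<open>p s\<close> vanishes, and
    nonpositive at s = w - h, where \<open>p (s + h)\<close> vanishes.\<close>
  have "\<exists>s. 0 \<le> s \<and> s \<le> w - h \<and> p (s + h) - p s = 0"
  proof (rule IVT2')
    have "continuous_on {0..w - h} (\<lambda>s. p (s + h))"
      by (rule continuous_on_compose2[OF cont]) (use h in \<open>auto intro!: continuous_intros\<close>)
    moreover have "continuous_on {0..w - h} p" by (rule continuous_on_subset[OF cont]) (use h in auto)
    ultimately show "continuous_on {0..w - h} (\<lambda>s. p (s + h) - p s)" by (intro continuous_intros)
  qed (use h p_nonneg p0[of 0] p0[of w] in auto)
  then obtain s where s: "0 \<le> s" "s \<le> w - h" "p (s + h) = p s" by auto
  \<comment> \<open>The masses 0 and \<open>w\<close> need not be attained at any point of the line,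
    so in the end cases a half-line beyond a zero of \<open>\<psi>\<close> is removed instead of a
    chord.\<close>
  consider "s = 0" | "s = w - h" | "0 < s" "s < w - h" using s by linarith
  then show ?thesis
  proof cases
    case 1
    then have "\<psi> (Y h) = 0" using s p0[of 0] pY[of h] h by simp
    then show ?thesis
      using tau_le_of_zero_left[OF c m, of "Y h" h] nn_integral_cum_mass(1)[OF c, of "Y h"] h by (simp add: Y)
  next
    case 2
    then have "\<psi> (Y (w - h)) = 0" using s p0[of w] pY[of "w - h"] h by simp
    then show ?thesis
      using tau_le_of_zero_right[OF c m, of "Y (w - h)" h] nn_integral_cum_mass(2)[OF c, of "Y (w - h)"] h by (simp add: Y)
  next
    case 3
    have eq: "\<psi> (Y s) = \<psi> (Y (s + h))" using s pY[of s] pY[of "s + h"] 3 h by simp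
    have le: "Y s \<le> Y (s + h)"
      using cum_mass_mono[OF c, of "Y (s + h)" "Y s"] Y[of s] Y[of "s + h"] 3 h by linarith
    show ?thesis
      using tau_le_of_chord[OF c m le eq, of h] nn_integral_cum_mass(5)[OF c le] 3 h by (simp add: Y)
  qed
qed

text \<open>The extreme case in which the whole line is removed; it supplies the bound at mass 0,
  which \<open>tau_decrease\<close> excludes.\<close>

lemma rate_times_mass_le_energy:
  assumes c: "competitor z \<psi> g w e" and m: "m > 0" "\<And>y. \<psi> y \<le> m"
  shows "z m * w \<le> e"
proof -
  have p: "0 \<le> e" "(\<integral>\<^sup>+y. ennreal (\<psi> y) \<partial>lborel) = ennreal w"
    "(\<integral>\<^sup>+y. energy_density z (\<psi> y) (g y) \<partial>lborel) \<le> ennreal e"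
    using c by (auto simp: competitor_def)
  have "ennreal (z m * w) \<le> (\<integral>\<^sup>+y. energy_density z (\<psi> y) (g y) \<partial>lborel)"
    using energy_of_removed_part[OF c m, of UNIV w] p by simp
  also note p(3)
  finally show ?thesis using p(1) by (simp add: ennreal_le_iff)
qed

lemma tau_supergradient:
  assumes t: "tau z w < ereal e" and w: "w > 0"
  obtains m where "m > 0" "\<And>w'. w' \<ge> 0 \<Longrightarrow> tau z w' \<le> ereal (e + z m * (w' - w))"
proof -
  obtain \<psi> g where c: "competitor z \<psi> g w e" using tau_less_competitor[OF t] w by auto
  have e: "e > 0" using t tau_nonneg[of z w] by (metis ereal_less(2) order_le_less_trans)
  obtain y where y: "\<psi> y > 0" "\<And>x. \<psi> x \<le> \<psi> y" using competitor_max[OF c e w] by blast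
  show ?thesis
  proof (rule that[OF y(1)])
    fix w' :: real assume w': "w' \<ge> 0"
    consider "w' = 0" | "0 < w'" "w' < w" | "w \<le> w'" using w' by linarith
    then show "tau z w' \<le> ereal (e + z (\<psi> y) * (w' - w))"
    proof cases
      case 1
      then show ?thesis using rate_times_mass_le_energy[OF c y] by (simp add: tau_zero)
    next
      case 2
      then show ?thesis using tau_decrease[OF c e _ _ y, of "w - w'"] by (simp add: algebra_simps)
    next
      case 3
      then obtain \<psi>' g' where "competitor z \<psi>' g' (w + (w' - w)) (e + z (\<psi> y) * (w' - w))"
        using competitor_insert_plateau[OF c y(1), of "w' - w"] by auto
      from competitor_tau_le[OF this] show ?thesis by simp
    qed
  qed
qed

text \<open>If this failed, there would be a competitor with energy below \<open>K * h\<close>. A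
  value above \<open>m\<close> would require more mass than \<open>m ^ 3 / (16 * K * h)\<close>,
  which \<open>small\<close> forbids; so the profile stays below \<open>m\<close> and pays at least
  \<open>K\<close> per unit of mass.\<close>

lemma tau_ge_of_rate_ge:
  assumes K: "\<And>\<phi>. 0 < \<phi> \<Longrightarrow> \<phi> \<le> m \<Longrightarrow> K \<le> z \<phi>" and m: "m > 0" and h: "h > 0"
    and small: "16 * K * h\<^sup>2 \<le> m ^ 3"
  shows "ereal (K * h) \<le> tau z h"
proof (rule ccontr)
  assume "\<not> ?thesis"
  then have "tau z h < ereal (K * h)" by simp
  then obtain e where e: "tau z h < ereal e" "e < K * h" using ereal_dense2 by force
  obtain \<psi> g where c: "competitor z \<psi> g h e" using tau_less_competitor[OF e(1)] h by auto
  have e0: "e > 0" using e(1) tau_nonneg[of z h] by (metis ereal_less(2) order_le_less_trans)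
  have "\<psi> y \<le> m" for y
  proof (rule ccontr)
    assume "\<not> ?thesis"
    then have y: "m < \<psi> y" by simp
    have "\<psi> y ^ 3 / (16 * e) \<le> h"
      using cum_mass_of_large_value(1)[OF c e0, of "\<psi> y" y] nn_integral_cum_mass(4)[OF c, of y] y m by simp
    then have "\<psi> y ^ 3 \<le> 16 * e * h" using e0 by (simp add: field_simps)
    also have "\<dots> < 16 * (K * h) * h" using e(2) h by simp
    also have "\<dots> \<le> m ^ 3" using small by (simp add: power2_eq_square mult_ac)
    finally show False using y m power_mono[of m "\<psi> y" 3] by linarith
  qed
  then have "z m * h \<le> e" using rate_times_mass_le_energy[OF c m] by simp
  moreover have "K * h \<le> z m * h" using K[OF m] h by simp
  ultimately show False using e(2) by simp
qed

lemma tau_eventually_le_affine: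
  assumes fin: "tau z w < \<infinity>" and w: "w > 0" and M: "M > 0"
  obtains w1 C where "w1 \<ge> 0" "\<And>v. v \<ge> w1 \<Longrightarrow> tau z v \<le> ereal (C + z M * (v - w1))"
proof -
  obtain e where "tau z w < ereal e" using fin by (metis ereal_dense2)
  then obtain \<psi> g where c: "competitor z \<psi> g w e" and e: "e > 0"
    using tau_less_competitor[of z w e] w tau_nonneg[of z w] by (metis ereal_less(2) order_le_less_trans less_imp_le)
  obtain y where y: "\<psi> y > 0" "\<And>x. \<psi> x \<le> \<psi> y" using competitor_max[OF c e w] by blast
  \<comment> \<open>Stretching the maximum to height at least \<open>M\<close> makes further
    plateaus cost at most \<open>z M\<close> per unit of mass; the maximum with 1 meets the
    condition of \<open>competitor_scale\<close>.\<close>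
  define k where "k = max 1 (M / \<psi> y)"
  have k: "k \<ge> 1" "k * \<psi> y \<ge> M" using y by (auto simp: k_def max_def field_simps)
  have c': "competitor z (\<lambda>y. k * \<psi> y) (\<lambda>y. k * g y) (k * w) (k\<^sup>2 * e)" by (rule competitor_scale[OF c k(1)])
  show ?thesis
  proof (rule that[of "k * w" "k\<^sup>2 * e"])
    show "0 \<le> k * w" using k w by simp
    fix v assume v: "k * w \<le> v"
    obtain \<psi>' g' where "competitor z \<psi>' g' (k * w + (v - k * w)) (k\<^sup>2 * e + z (k * \<psi> y) * (v - k * w))"
      by (rule competitor_insert_plateau[OF c', of y "v - k * w"]) (use k y v in auto)
    from competitor_tau_le[OF this] have "tau z v \<le> ereal (k\<^sup>2 * e + z (k * \<psi> y) * (v - k * w))" by simp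
    also have "\<dots> \<le> ereal (k\<^sup>2 * e + z M * (v - k * w))"
      using v k M by (auto intro!: mult_right_mono z_noninc)
    finally show "tau z v \<le> ereal (k\<^sup>2 * e + z M * (v - k * w))" .
  qed
qed

lemma exponential_competitor:
  assumes L: "\<And>\<phi>. 0 < \<phi> \<Longrightarrow> z \<phi> \<le> L" and h: "h > 0" and b: "b > 0"
  obtains \<psi> g where "competitor z \<psi> g h (L * h + b ^ 3 * h\<^sup>2 / 4)"
proof -
  \<comment> \<open>The profile is k * exp (- b * |y|), of mass 2 * k / b = h. As |g| = b * \<psi>
    and \<psi> \<le> k, its gradient energy is at most b^2 * k / 2 * h = b^3 * h^2 / 4.\<close>
  define k where "k = h * b / 2"
  have k: "k > 0" using h b by (simp add: k_def)
  have L0: "0 \<le> L" using L[of 1] z_nonneg[of 1] by simp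
  define \<psi> where "\<psi> y = (if y \<le> 0 then k * exp (b * y) else k * exp (- (b * y)))" for y
  define g where "g y = (if y \<le> 0 then k * (exp (b * y) * b) else k * (exp (- (b * y)) * - b))" for y
  have "ac_with \<psi> g" unfolding \<psi>_def g_def
  proof (rule ac_with_join)
    show "ac_with (\<lambda>y. k * exp (b * y)) (\<lambda>y. k * (exp (b * y) * b))"
      by (rule ac_with_of_has_deriv) (auto intro!: derivative_eq_intros continuous_intros)
    show "ac_with (\<lambda>y. k * exp (- (b * y))) (\<lambda>y. k * (exp (- (b * y)) * - b))"
      by (rule ac_with_of_has_deriv) (auto intro!: derivative_eq_intros continuous_intros)
  qed simp
  have pos: "\<psi> y > 0" for y using k by (simp add: \<psi>_def)
  have le_k: "\<psi> y \<le> k" for y using k b by (auto simp: \<psi>_def mult_le_0_iff)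
  have g2: "(g y)\<^sup>2 = b\<^sup>2 * (\<psi> y)\<^sup>2" for y by (simp add: g_def \<psi>_def power_mult_distrib)
  have [measurable]: "\<psi> \<in> borel_measurable borel"
    by (rule borel_measurable_continuous_onI[OF ac_with_continuous[OF \<open>ac_with \<psi> g\<close>]])
  have half: "(\<integral>\<^sup>+y. ennreal (k * exp (- (b * y))) * indicator {0..} y \<partial>lborel) = ennreal (k / b)"
  proof -
    have "(\<integral>\<^sup>+y. ennreal (k * exp (- (b * y))) * indicator {0..} y \<partial>lborel) = ennreal (0 - (- (k / b) * exp (- (b * 0))))"
    proof (rule nn_integral_FTC_atLeast)
      show "((\<lambda>y. - (k / b) * exp (- (b * y))) has_real_derivative k * exp (- (b * y))) (at y)" for y
        using b by (auto intro!: derivative_eq_intros)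
      have "((\<lambda>y. - (k / b) * exp (- (b * y))) \<longlongrightarrow> - (k / b) * 0) at_top"
        by (intro tendsto_intros filterlim_compose[OF exp_at_bot]
            filterlim_compose[OF filterlim_uminus_at_bot_at_top]
            filterlim_tendsto_pos_mult_at_top[OF tendsto_const b filterlim_ident])
      then show "((\<lambda>y. - (k / b) * exp (- (b * y))) \<longlongrightarrow> 0) at_top" by simp
    qed (use k in auto)
    then show ?thesis by simp
  qed
  have right: "(\<integral>\<^sup>+y. ennreal (\<psi> y) * indicator {0<..} y \<partial>lborel) = ennreal (k / b)"
    unfolding half[symmetric]
    by (rule nn_integral_cong_AE)
      (use AE_lborel_singleton[of 0] in \<open>auto elim!: eventually_mono simp: \<psi>_def indicator_def\<close>)
  have left: "(\<integral>\<^sup>+y. ennreal (\<psi> y) * indicator {..0} y \<partial>lborel) = ennreal (k / b)"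
    unfolding half[symmetric]
    by (subst nn_integral_real_affine[of _ "-1" 0]) (auto intro!: nn_integral_cong simp: \<psi>_def indicator_def)
  have "(\<integral>\<^sup>+y. ennreal (\<psi> y) \<partial>lborel) = ennreal (k / b) + ennreal (k / b)"
    by (subst nn_integral_split_at[of _ 0]) (auto simp: left right)
  also have "\<dots> = ennreal h" using h b by (simp add: k_def flip: ennreal_plus)
  finally have mass: "(\<integral>\<^sup>+y. ennreal (\<psi> y) \<partial>lborel) = ennreal h" .
  have B: "0 \<le> L + b\<^sup>2 * k / 2" using L0 k by simp
  have "energy_density z (\<psi> y) (g y) \<le> ennreal (L + b\<^sup>2 * k / 2) * ennreal (\<psi> y)" for y
  proof -
    have "(g y)\<^sup>2 / 2 \<le> b\<^sup>2 * k / 2 * \<psi> y"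
    proof -
      have "(\<psi> y)\<^sup>2 \<le> k * \<psi> y" using le_k[of y] pos[of y] by (simp add: power2_eq_square)
      then show ?thesis unfolding g2 using mult_left_mono[of "(\<psi> y)\<^sup>2" "k * \<psi> y" "b\<^sup>2"] by simp
    qed
    moreover have "c_of z (\<psi> y) \<le> L * \<psi> y" using pos[of y] L[OF pos[of y]] by (simp add: c_of_def)
    ultimately have "(g y)\<^sup>2 / 2 + c_of z (\<psi> y) \<le> (L + b\<^sup>2 * k / 2) * \<psi> y" by (simp add: algebra_simps)
    then show ?thesis unfolding energy_density_def ennreal_mult'[OF B, symmetric] by (rule ennreal_leI)
  qed
  then have "(\<integral>\<^sup>+y. energy_density z (\<psi> y) (g y) \<partial>lborel) \<le> (\<integral>\<^sup>+y. ennreal (L + b\<^sup>2 * k / 2) * ennreal (\<psi> y) \<partial>lborel)"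
    by (rule nn_integral_mono)
  also have "\<dots> = ennreal (L + b\<^sup>2 * k / 2) * ennreal h" by (simp add: nn_integral_cmult mass)
  also have "\<dots> = ennreal (L * h + b ^ 3 * h\<^sup>2 / 4)"
    unfolding ennreal_mult'[OF B, symmetric] by (simp add: k_def power2_eq_square power3_eq_cube algebra_simps)
  finally have "competitor z \<psi> g h (L * h + b ^ 3 * h\<^sup>2 / 4)"
    using \<open>ac_with \<psi> g\<close> mass pos L0 h b by (simp add: competitor_def less_imp_le)
  then show ?thesis by (rule that)
qed

text \<open>Flattening the exponential profile by letting \<open>b\<close> tend to 0 removes the
  gradient energy.\<close>

lemma tau_le_of_rate_le:
  assumes L: "\<And>\<phi>. 0 < \<phi> \<Longrightarrow> z \<phi> \<le> L" and h: "h > 0"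
  shows "tau z h \<le> ereal (L * h)"
proof (rule tendsto_lowerbound)
  have "((\<lambda>b. L * h + b ^ 3 * h\<^sup>2 / 4) \<longlongrightarrow> L * h + 0 ^ 3 * h\<^sup>2 / 4) (at_right 0)"
    by (intro tendsto_intros) auto
  then show "((\<lambda>b. ereal (L * h + b ^ 3 * h\<^sup>2 / 4)) \<longlongrightarrow> ereal (L * h)) (at_right 0)" by simp
  show "\<forall>\<^sub>F b in at_right 0. tau z h \<le> ereal (L * h + b ^ 3 * h\<^sup>2 / 4)"
    using eventually_at_right_less[of 0]
  proof eventually_elim
    case (elim b)
    obtain \<psi> g where "competitor z \<psi> g h (L * h + b ^ 3 * h\<^sup>2 / 4)"
      by (rule exponential_competitor[OF L h elim])
    then show ?case by (rule competitor_tau_le)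
  qed
qed simp

section \<open>The right derivative at 0\<close>

lemma tau_right_deriv_0:
  assumes L0: "((\<lambda>\<phi>. ereal (z \<phi>)) \<longlongrightarrow> L0) (at_right 0)"
  shows "((\<lambda>h. (tau z h - tau z 0) / ereal h) \<longlongrightarrow> L0) (at_right 0)"
proof (rule order_tendstoI)
  fix a assume "a < L0"
  then obtain K where K: "a < ereal K" "ereal K < L0" using ereal_dense2 by blast
  obtain b where b: "b > 0" "\<And>\<phi>. 0 < \<phi> \<Longrightarrow> \<phi> < b \<Longrightarrow> K < z \<phi>"
    using order_tendstoD(1)[OF L0 K(2)] by (auto simp: eventually_at_right_field)
  \<comment> \<open>The smallness condition of \<open>tau_ge_of_rate_ge\<close> is quadratic in
    \<open>h\<close>, so it holds for all small \<open>h\<close>.\<close>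
  have "((\<lambda>h. 16 * K * h\<^sup>2) \<longlongrightarrow> 16 * K * 0\<^sup>2) (at_right 0)"
    by (intro tendsto_intros)
  then have "\<forall>\<^sub>F h in at_right 0. 16 * K * h\<^sup>2 < (b / 2) ^ 3"
    using b by (intro order_tendstoD) auto
  then show "\<forall>\<^sub>F h in at_right 0. a < (tau z h - tau z 0) / ereal h"
    using eventually_at_right_less[of "0 :: real"]
  proof eventually_elim
    case (elim h)
    \<comment> \<open>The threshold is \<open>b / 2\<close> because the bound on \<open>z\<close> is
      known only strictly below \<open>b\<close>.\<close>
    have "ereal (K * h) \<le> tau z h"
      by (rule tau_ge_of_rate_ge[of "b / 2"]) (use b elim in \<open>auto intro: less_imp_le\<close>)
    then have "ereal K \<le> tau z h / ereal h"
      using elim by (subst ereal_le_divide_pos) (auto simp: mult.commute)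
    then show ?case using K(1) by (simp add: tau_zero)
  qed
next
  fix a assume a: "L0 < a"
  have z_le: "ereal (z \<phi>) \<le> L0" if "\<phi> > 0" for \<phi>
  proof (rule tendsto_lowerbound[OF L0])
    show "\<forall>\<^sub>F s in at_right 0. ereal (z \<phi>) \<le> ereal (z s)"
      unfolding eventually_at_right_field using that by (intro exI[of _ \<phi>]) (auto intro: z_noninc)
  qed simp
  \<comment> \<open>\<open>L0\<close> is finite, lying below \<open>a\<close> and above the real
    number \<open>z 1\<close>.\<close>
  obtain L where L: "L0 = ereal L"
    using z_le[of 1] a by (cases L0) auto
  show "\<forall>\<^sub>F h in at_right 0. (tau z h - tau z 0) / ereal h < a"
    using eventually_at_right_less[of "0 :: real"]
  proof eventually_elim
    case (elim h)
    have "tau z h \<le> ereal (L * h)" by (rule tau_le_of_rate_le) (use z_le elim L in auto)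
    then have "tau z h / ereal h \<le> ereal L"
      using elim by (subst ereal_divide_le_pos) (auto simp: mult.commute)
    then show ?case using a L by (simp add: tau_zero)
  qed
qed

section \<open>Concavity and the limit of the right derivatives\<close>

lemma tau_concave:
  assumes T: "\<And>w. w \<ge> 0 \<Longrightarrow> tau z w = ereal (T w)" and "0 \<le> a" "a < w" "w < b"
  shows "(b - w) * T a + (w - a) * T b \<le> (b - a) * T w"
proof (rule field_le_epsilon)
  fix r :: real assume r: "r > 0"
  \<comment> \<open>The error of the approximate supergradient, which the weights multiply by b - a
    in total.\<close>
  define q where "q = r / (b - a)"
  have q: "q > 0" "(b - a) * q = r" using r assms by (auto simp: q_def)
  have "tau z w < ereal (T w + q)" using T[of w] assms q by simp
  then obtain m where m: "m > 0" "\<And>w'. w' \<ge> 0 \<Longrightarrow> tau z w' \<le> ereal (T w + q + z m * (w' - w))"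
    using tau_supergradient[of w "T w + q"] assms by auto
  have "T a \<le> T w + q + z m * (a - w)" "T b \<le> T w + q + z m * (b - w)"
    using m(2)[of a] m(2)[of b] T[of a] T[of b] assms by auto
  then have "(b - w) * T a + (w - a) * T b \<le>
      (b - w) * (T w + q + z m * (a - w)) + (w - a) * (T w + q + z m * (b - w))"
    using assms by (intro add_mono mult_left_mono) auto
  \<comment> \<open>With these weights the two slope terms cancel.\<close>
  also have "\<dots> = (b - a) * T w + (b - a) * q" by (simp add: algebra_simps)
  finally show "(b - w) * T a + (w - a) * T b \<le> (b - a) * T w + r" using q by simp
qed

text \<open>The approximate supergradient at \<open>w + h\<close> has slope \<open>z m\<close>, at
  least \<open>L\<close>; it is evaluated back at \<open>w\<close>.\<close>

lemma tau_slope_ge: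
  assumes T: "\<And>w. w \<ge> 0 \<Longrightarrow> tau z w = ereal (T w)" and L: "\<And>\<phi>. 0 < \<phi> \<Longrightarrow> L \<le> z \<phi>"
    and w: "w \<ge> 0" and h: "h > 0"
  shows "L \<le> (T (w + h) - T w) / h"
proof -
  have "T w + L * h \<le> T (w + h)"
  proof (rule field_le_epsilon)
    fix q :: real assume q: "q > 0"
    have "tau z (w + h) < ereal (T (w + h) + q)" using T[of "w + h"] w h q by simp
    then obtain m where m: "m > 0" "\<And>w'. w' \<ge> 0 \<Longrightarrow> tau z w' \<le> ereal (T (w + h) + q + z m * (w' - (w + h)))"
      using tau_supergradient[of "w + h" "T (w + h) + q"] w h by auto
    have "T w \<le> T (w + h) + q - z m * h" using m(2)[OF w] T[OF w] by (simp add: algebra_simps)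
    moreover have "L * h \<le> z m * h" using L[OF m(1)] h by simp
    ultimately show "T w + L * h \<le> T (w + h) + q" by simp
  qed
  then show ?thesis using h by (simp add: field_simps)
qed

lemma tau_right_deriv_limit:
  assumes Linf: "((\<lambda>\<phi>. ereal (z \<phi>)) \<longlongrightarrow> Linf) at_top" and fin: "\<forall>w\<ge>0. tau z w \<noteq> \<infinity>"
  shows "\<exists>d :: real \<Rightarrow> ereal.
      (\<forall>w\<ge>0. ((\<lambda>h. (tau z (w + h) - tau z w) / ereal h) \<longlongrightarrow> d w) (at_right 0)) \<and> (d \<longlongrightarrow> Linf) at_top"
proof -
  define T where "T w = real_of_ereal (tau z w)" for w
  have T: "tau z w = ereal (T w)" if "w \<ge> 0" for w
    using fin that tau_nonneg[of z w] unfolding T_def by (cases "tau z w") auto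
  have T0: "T 0 = 0" by (simp add: T_def tau_zero)
  define S where "S w h = (T (w + h) - T w) / h" for w h
  have quot: "(tau z (w + h) - tau z w) / ereal h = ereal (S w h)" if "w \<ge> 0" "h > 0" for w h
    using that by (simp add: T S_def)
  have S_antimono: "S w h2 \<le> S w h1" if "w \<ge> 0" "0 < h1" "h1 < h2" for w h1 h2
    using tau_concave[OF T, of w "w + h1" "w + h2"] that by (simp add: S_def field_simps)
  \<comment> \<open>Concavity and \<open>T 0 = 0\<close> bound every forward slope at
    \<open>w\<close> by the slope of the chord from the origin, which turns a growth bound on
    \<open>T\<close> into a bound on its derivative.\<close>
  have S_le: "S w h \<le> T w / w" if "w > 0" "h > 0" for w h
    using tau_concave[OF T, of 0 w "w + h"] that T0 by (simp add: S_def field_simps)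
  \<comment> \<open>Forward slopes grow as \<open>h\<close> shrinks, so the right derivative is
    their supremum. It is extended real because it is infinite at w = 0 when \<open>z\<close> is
    unbounded near 0.\<close>
  define d where "d w = (SUP h\<in>{0<..}. ereal (S w h))" for w
  have "((\<lambda>h. (tau z (w + h) - tau z w) / ereal h) \<longlongrightarrow> d w) (at_right 0)" if w: "w \<ge> 0" for w
  proof (rule order_tendstoI)
    fix a assume "a < d w"
    then obtain h0 where h0: "h0 > 0" "a < ereal (S w h0)" unfolding d_def less_SUP_iff by auto
    have "a < (tau z (w + h) - tau z w) / ereal h" if "0 < h" "h < h0" for h
    proof -
      have "ereal (S w h0) \<le> ereal (S w h)" using S_antimono[OF w that] by simp
      then show ?thesis using h0 quot[OF w \<open>0 < h\<close>] by (metis order_less_le_trans)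
    qed
    then show "\<forall>\<^sub>F h in at_right 0. a < (tau z (w + h) - tau z w) / ereal h"
      unfolding eventually_at_right_field using h0 by blast
  next
    fix a assume a: "d w < a"
    show "\<forall>\<^sub>F h in at_right 0. (tau z (w + h) - tau z w) / ereal h < a"
      using eventually_at_right_less[of "0 :: real"]
    proof eventually_elim
      case (elim h)
      have "ereal (S w h) \<le> d w" unfolding d_def by (rule SUP_upper) (use elim in simp)
      then show ?case using a quot[OF w elim] by (metis order_le_less_trans)
    qed
  qed
  moreover have "(d \<longlongrightarrow> Linf) at_top"
  proof (rule order_tendstoI)
    have z_ge: "Linf \<le> ereal (z \<phi>)" if "\<phi> > 0" for \<phi>
    proof (rule tendsto_upperbound[OF Linf])
      show "\<forall>\<^sub>F s in at_top. ereal (z s) \<le> ereal (z \<phi>)"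
        using eventually_ge_at_top[of \<phi>] by eventually_elim (use that z_noninc in simp)
    qed simp
    fix a assume a: "a < Linf"
    have d_ge: "Linf \<le> d w" if "w > 0" for w
    proof -
      \<comment> \<open>\<open>a < Linf\<close> rules out minus infinity and \<open>z_ge\<close>
        rules out plus infinity.\<close>
      obtain L where L: "Linf = ereal L"
        using z_ge[of 1] a by (cases Linf) auto
      have "L \<le> S w 1" unfolding S_def by (rule tau_slope_ge[OF T]) (use z_ge L that in auto)
      then have "Linf \<le> ereal (S w 1)" by (simp add: L)
      also have "\<dots> \<le> d w" unfolding d_def by (rule SUP_upper) simp
      finally show ?thesis .
    qed
    show "\<forall>\<^sub>F w in at_top. a < d w"
      using eventually_gt_at_top[of 0] by eventually_elim (use a d_ge order_less_le_trans in blast)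
  next
    fix a assume "Linf < a"
    from eventually_conj[OF order_tendstoD(2)[OF Linf this] eventually_gt_at_top[of 0]]
    obtain M where M: "ereal (z M) < a" "M > 0" by (auto dest!: eventually_happens)
    obtain q where q: "ereal (z M) < ereal q" "ereal q < a" using ereal_dense2[OF M(1)] by blast
    obtain w1 C where w1: "w1 \<ge> 0" "\<And>v. v \<ge> w1 \<Longrightarrow> tau z v \<le> ereal (C + z M * (v - w1))"
      using tau_eventually_le_affine[of 1 M] fin M by (auto simp: less_top[symmetric] top_ereal_def)
    \<comment> \<open>Dividing the affine bound by \<open>v\<close> leaves \<open>z M\<close> in the
      limit, so by \<open>S_le\<close> the right derivatives are eventually at most
      \<open>q\<close>.\<close>
    have "((\<lambda>v. (C - z M * w1) / v + z M) \<longlongrightarrow> 0 + z M) at_top"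
      by (intro tendsto_intros tendsto_divide_0[OF tendsto_const] filterlim_at_top_imp_at_infinity filterlim_ident)
    then have "\<forall>\<^sub>F v in at_top. (C - z M * w1) / v + z M < q"
      using q(1) by (intro order_tendstoD) auto
    then show "\<forall>\<^sub>F w in at_top. d w < a"
      using eventually_gt_at_top[of w1]
    proof eventually_elim
      case (elim v)
      have v: "v > 0" using elim w1 by simp
      have "T v \<le> C + z M * (v - w1)" using w1(2)[of v] T[of v] elim v by simp
      then have "T v / v \<le> (C + z M * (v - w1)) / v" using v by (simp add: divide_right_mono)
      also have "\<dots> = (C - z M * w1) / v + z M" using v by (simp add: field_simps)
      finally have "T v / v < q" using elim by simp
      moreover have "d v \<le> ereal (T v / v)" unfolding d_def by (rule SUP_least) (use S_le v in simp)
      ultimately show ?case using q(2) by (metis ereal_less_eq(3) less_imp_le order_le_less_trans)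
    qed
  qed
  ultimately show ?thesis by blast
qed

end

text \<open>By \<open>tau_supergradient\<close>, finiteness of \<open>tau z\<close> at one positive
  mass implies finiteness at every mass. So the premise of the second part excludes only the case in
  which \<open>tau z\<close> is infinite at all positive masses, where the quotients would be
  differences of infinities.\<close>

theorem mainTheorem6:
  fixes z :: "real \<Rightarrow> real" and L0 Linf :: ereal
  assumes z_nonneg: "\<And>\<phi>. \<phi> > 0 \<Longrightarrow> z \<phi> \<ge> 0"
    and z_noninc: "\<And>\<phi> s. 0 < \<phi> \<Longrightarrow> \<phi> \<le> s \<Longrightarrow> z s \<le> z \<phi>"
    and L0: "((\<lambda>\<phi>. ereal (z \<phi>)) \<longlongrightarrow> L0) (at_right 0)"
    and Linf: "((\<lambda>\<phi>. ereal (z \<phi>)) \<longlongrightarrow> Linf) at_top"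
  shows "((\<lambda>h. (tau z h - tau z 0) / ereal h) \<longlongrightarrow> L0) (at_right 0) \<and>
         ((\<forall>w\<ge>0. tau z w \<noteq> \<infinity>) \<longrightarrow>
           (\<exists>d :: real \<Rightarrow> ereal.
              (\<forall>w\<ge>0. ((\<lambda>h. (tau z (w + h) - tau z w) / ereal h) \<longlongrightarrow> d w) (at_right 0))
              \<and> (d \<longlongrightarrow> Linf) at_top))"
proof -
  interpret nonincreasing_rate z
    by unfold_locales (fact z_nonneg z_noninc)+
  show ?thesis
    using tau_right_deriv_0[OF L0] tau_right_deriv_limit[OF Linf] by blast
qed

end
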